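(* Let $H$ be a path with at least $2$ edges or a cycle and let $W:[0,1]^2\to\mathbb{R}$ be a kernel. For any $\varepsilon\ge 0$, if \[ t_{H}(W)+t_{H}(1-W)\leq 2^{1-e(H)}(1+\varepsilon), \] then \[ t_{P_2}(2W-1)\leq \frac{\varepsilon}{e(H)-1}. \]
   Context: A kernel is a bounded symmetric measurable function $W:[0,1]^2\to\mathbb{R}$. For a graph $F$, $t_F(W):=\int_{[0,1]^{V(F)}}\prod_{ij\in E(F)}W(x_i,x_j)\prod_{i\in V(F)}dx_i$. $e(H)$ is the number of edges of $H$; $P_2$ is the path with $2$ edges; $1-W$ and $2W-1$ denote the kernels $(x,y)\mapsto 1-W(x,y)$ and $(x,y)\mapsto 2W(x,y)-1$. *)

theory Defs
  imports "HOL-Analysis.Analysis"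
begin

type_synonym 'a graph = "'a set \<times> 'a set set"

abbreviation verts :: "'a graph \<Rightarrow> 'a set" where
  "verts \<equiv> fst"

abbreviation edges :: "'a graph \<Rightarrow> 'a set set" where
  "edges \<equiv> snd"

definition simple_graph :: "'a graph \<Rightarrow> bool" where
  "simple_graph G \<longleftrightarrow>
     finite (verts G) \<and> (\<forall>e\<in>edges G. e \<subseteq> verts G \<and> card e = 2)"

definition graph_iso :: "'a graph \<Rightarrow> 'b graph \<Rightarrow> bool" where
  "graph_iso G H \<longleftrightarrow>
     (\<exists>f. bij_betw f (verts G) (verts H) \<and> edges H = (\<lambda>e. f ` e) ` edges G)"

text \<open>The index of a path counts edges, so \<open>path_graph k\<close> has \<open>k + 1\<close> vertices.\<close>

definition path_graph :: "nat \<Rightarrow> nat graph" where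
  "path_graph k = ({..k}, {{i, Suc i} |i. i < k})"

definition cycle_graph :: "nat \<Rightarrow> nat graph" where
  "cycle_graph n = ({..<n}, {{i, Suc i mod n} |i. i < n})"

definition is_path :: "'a graph \<Rightarrow> bool" where
  "is_path G \<longleftrightarrow> simple_graph G \<and> (\<exists>k. graph_iso G (path_graph k))"

definition is_cycle :: "'a graph \<Rightarrow> bool" where
  "is_cycle G \<longleftrightarrow> simple_graph G \<and> (\<exists>n\<ge>3. graph_iso G (cycle_graph n))"

text \<open>Measurability is Lebesgue measurability on the unit square. Only the values of \<open>W\<close>
  on the unit square are relevant here and below.\<close>

definition is_kernel :: "(real \<Rightarrow> real \<Rightarrow> real) \<Rightarrow> bool" where
  "is_kernel W \<longleftrightarrow>
     (\<lambda>(x, y). W x y) \<in> borel_measurable (lebesgue_on ({0..1} \<times> {0..1})) \<and>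
     (\<forall>x\<in>{0..1}. \<forall>y\<in>{0..1}. W x y = W y x) \<and>
     (\<exists>B. \<forall>x\<in>{0..1}. \<forall>y\<in>{0..1}. \<bar>W x y\<bar> \<le> B)"

text \<open>The choice of an order of the two endpoints of an edge is irrelevant for symmetric \<open>W\<close>.
  The product measure is completed so that the integrand is measurable for every
  Lebesgue measurable kernel, not only for Borel measurable ones.\<close>

definition hom_density :: "'a graph \<Rightarrow> (real \<Rightarrow> real \<Rightarrow> real) \<Rightarrow> real" where
  "hom_density F W =
     (LINT x|completion (PiM (verts F) (\<lambda>_. restrict_space lborel {0..1})).
        (\<Prod>e\<in>edges F. case (SOME (i, j). e = {i, j}) of (i, j) \<Rightarrow> W (x i) (x j)))"

end

theory Submission
  imports Defs "HOL-Probability.Probability" "HOL-Computational_Algebra.Formal_Power_Series"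
begin

text \<open>Write \<open>U = 2 W - 1\<close> and let \<open>m\<^sub>k = \<langle>1, U\<^sup>k 1\<rangle>\<close> be the density of the path with \<open>k\<close> edges in \<open>U\<close>,
  with generating function \<open>G\<close>. As \<open>2 W = J + U\<close> with \<open>J\<close> of rank one, the density of the path with
  \<open>n\<close> edges in \<open>2 W\<close> is the sum over \<open>r\<close> of the coefficients of \<open>z ^ (n - r)\<close> in \<open>G ^ (r + 1)\<close>. For the cycle
  of length \<open>n\<close>, a trace computation gives the coefficients of \<open>z ^ (n - 1 - r)\<close> in \<open>G ^ (r + 1)\<close> weighted
  by \<open>n / (r + 1)\<close>, plus the trace of \<open>U\<^sup>n\<close>. Replacing \<open>U\<close> by \<open>- U\<close> and adding cancels the
  coefficients of odd degree. Those of even degree are nonnegative by Hunter's positivity of the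
  complete homogeneous symmetric polynomials of even degree, which appears here as follows: the
  sequence \<open>k! [z\<^sup>k] G\<^sup>n\<close> is the moment sequence of a sum of \<open>n\<close> independent variables, so its Hankel
  matrices are positive semidefinite. The degrees 0 and 2 alone give the claimed bound.\<close>

section \<open>Even coefficients of powers of moment generating functions\<close>

text \<open>The infinite Hankel matrix is tested on finitely supported vectors. Moment sequences
  have this property, and working with it directly avoids constructing the independent
  variables.\<close>

definition hankel_psd :: "(nat \<Rightarrow> real) \<Rightarrow> bool" where
  "hankel_psd a \<longleftrightarrow> (\<forall>N w. 0 \<le> (\<Sum>p\<le>N. \<Sum>q\<le>N. w p * w q * a (p + q)))"

lemma hankel_psd_even_nonneg:
  assumes "hankel_psd a"
  shows "0 \<le> a (2 * j)"
proof -
  have "0 \<le> (\<Sum>p\<le>j. \<Sum>q\<le>j. (if p = j then 1 else 0) * (if q = j then 1 else 0) * a (p + q))"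
    using assms[unfolded hankel_psd_def, rule_format, of "\<lambda>p. if p = j then 1 else 0" j] .
  also have "\<dots> = a (2 * j)"
    by (simp add: mult_delta_left mult_delta_right mult_2)
  finally show ?thesis .
qed

text \<open>Labels \<open>h a\<close> may repeat. Adding up the weights \<open>v a\<close> over each
  label gives an ordinary vector \<open>V\<close> on the indices. Below, pairs \<open>(p, i)\<close>
  carry the label \<open>p - i\<close>.\<close>

lemma hankel_psd_family:
  fixes v :: "'i \<Rightarrow> real"
  assumes "hankel_psd c" "finite A"
  shows "0 \<le> (\<Sum>a\<in>A. \<Sum>b\<in>A. v a * v b * c (h a + h b))"
proof -
  obtain N where N: "\<And>a. a \<in> A \<Longrightarrow> h a \<le> N"
    using \<open>finite A\<close> by (metis finite_nat_set_iff_bounded_le finite_imageI imageI)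
  define V where "V s = (\<Sum>a\<in>{a\<in>A. h a = s}. v a)" for s
  have group: "(\<Sum>a\<in>A. v a * g (h a)) = (\<Sum>s\<le>N. V s * g s)" for g
  proof -
    have "(\<Sum>a\<in>A. v a * g (h a)) = (\<Sum>s\<le>N. \<Sum>a\<in>{a\<in>A. h a = s}. v a * g (h a))"
      using N by (intro sum.group[symmetric] \<open>finite A\<close>) auto
    also have "\<dots> = (\<Sum>s\<le>N. V s * g s)"
      by (simp add: V_def sum_distrib_right)
    finally show ?thesis .
  qed
  have inner: "(\<Sum>b\<in>A. v b * c (s + h b)) = (\<Sum>t\<le>N. V t * c (s + t))" for s
    by (rule group)
  have "(\<Sum>a\<in>A. \<Sum>b\<in>A. v a * v b * c (h a + h b))
      = (\<Sum>a\<in>A. v a * (\<Sum>b\<in>A. v b * c (h a + h b)))"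
    by (simp add: sum_distrib_left mult.assoc)
  also have "\<dots> = (\<Sum>a\<in>A. v a * (\<Sum>t\<le>N. V t * c (h a + t)))"
    by (simp only: inner)
  also have "\<dots> = (\<Sum>s\<le>N. V s * (\<Sum>t\<le>N. V t * c (s + t)))"
    by (rule group)
  also have "\<dots> = (\<Sum>s\<le>N. \<Sum>t\<le>N. V s * V t * c (s + t))"
    by (simp add: sum_distrib_left mult.assoc)
  also have "0 \<le> \<dots>"
    using assms(1) unfolding hankel_psd_def by blast
  finally show ?thesis .
qed

section \<open>Binomial and factorial identities\<close>

lemma sum_binomial_Suc:
  fixes g :: "nat \<Rightarrow> 'a::comm_semiring_1"
  shows "(\<Sum>s\<le>Suc n. of_nat (Suc n choose s) * g s) = (\<Sum>s\<le>n. of_nat (n choose s) * (g s + g (Suc s)))"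
proof -
  have "(\<Sum>s\<le>Suc n. of_nat (Suc n choose s) * g s)
      = g 0 + (\<Sum>s\<le>n. of_nat (n choose Suc s) * g (Suc s)) + (\<Sum>s\<le>n. of_nat (n choose s) * g (Suc s))"
    by (subst sum.atMost_Suc_shift) (simp add: sum.distrib algebra_simps)
  also have "g 0 + (\<Sum>s\<le>n. of_nat (n choose Suc s) * g (Suc s)) = (\<Sum>s\<le>Suc n. of_nat (n choose s) * g s)"
    by (subst sum.atMost_Suc_shift) simp
  also have "\<dots> = (\<Sum>s\<le>n. of_nat (n choose s) * g s)"
    by (simp add: binomial_eq_0)
  finally show ?thesis
    by (simp add: sum.distrib algebra_simps)
qed

text \<open>Vandermonde convolution against a test function \<open>g\<close>: a subset of a disjoint
  union of \<open>p\<close> and \<open>q\<close> elements splits into parts of sizes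
  \<open>i\<close> and \<open>j\<close>. This separates the row index \<open>p\<close> from the
  column index \<open>q\<close>.\<close>

lemma sum_binomial_add:
  fixes g :: "nat \<Rightarrow> 'a::comm_semiring_1"
  shows "(\<Sum>s\<le>p + q. of_nat (p + q choose s) * g s)
       = (\<Sum>i\<le>p. \<Sum>j\<le>q. of_nat (p choose i) * of_nat (q choose j) * g (i + j))"
proof (induction p arbitrary: g)
  case (Suc p)
  have "(\<Sum>s\<le>Suc p + q. of_nat (Suc p + q choose s) * g s)
      = (\<Sum>s\<le>p + q. of_nat (p + q choose s) * (g s + g (Suc s)))"
    using sum_binomial_Suc[of "p + q" g] by simp
  also have "\<dots> = (\<Sum>i\<le>p. of_nat (p choose i)
      * ((\<Sum>j\<le>q. of_nat (q choose j) * g (i + j)) + (\<Sum>j\<le>q. of_nat (q choose j) * g (Suc i + j))))"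
    unfolding Suc.IH by (simp add: sum.distrib sum_distrib_left algebra_simps)
  also have "\<dots> = (\<Sum>i\<le>Suc p. of_nat (Suc p choose i) * (\<Sum>j\<le>q. of_nat (q choose j) * g (i + j)))"
    by (rule sum_binomial_Suc[symmetric])
  finally show ?case
    by (simp only: sum_distrib_left mult.assoc)
qed simp

text \<open>Dividing by \<open>fact i * fact j\<close> leaves Vandermonde's identity. The Hankel
  matrix of the factorials, the moments of the exponential distribution, thus becomes an explicit
  Gram matrix. Terms with \<open>k > i\<close> vanish, so one bound \<open>N\<close> serves all
  rows.\<close>

lemma fact_add_gram:
  assumes "i \<le> N"
  shows "fact (i + j) = (\<Sum>k\<le>N. (fact i * real (i choose k)) * (fact j * real (j choose k)))"
proof -
  have "(i + j) choose i = (\<Sum>k\<le>i. (i choose k) * (j choose (i - k)))"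
    by (rule vandermonde[symmetric])
  also have "\<dots> = (\<Sum>k\<le>i. (i choose (i - k)) * (j choose k))"
    by (rule sum.reindex_bij_witness[of _ "\<lambda>k. i - k" "\<lambda>k. i - k"]) auto
  also have "\<dots> = (\<Sum>k\<le>i. (i choose k) * (j choose k))"
    by (intro sum.cong refl) (simp add: binomial_symmetric[symmetric])
  also have "\<dots> = (\<Sum>k\<le>N. (i choose k) * (j choose k))"
    using assms by (intro sum.mono_neutral_left) auto
  finally have C: "(i + j) choose i = (\<Sum>k\<le>N. (i choose k) * (j choose k))" .
  have "fact (i + j) = fact i * fact j * real ((i + j) choose i)"
    using binomial_fact[of i "i + j", where 'a = real] by simp
  also have "\<dots> = (\<Sum>k\<le>N. (fact i * real (i choose k)) * (fact j * real (j choose k)))"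
    unfolding C by (simp add: sum_distrib_left algebra_simps)
  finally show ?thesis .
qed

text \<open>If \<open>m\<close> and \<open>c\<close> are the moments of independent random variables \<open>X\<close> and \<open>Y\<close>, then the new
  sequence is that of the moments of \<open>X * E + Y\<close>, where \<open>E\<close> is exponentially distributed and
  independent of both.\<close>
lemma hankel_psd_fps_mult:
  assumes int: "\<And>i j. integrable M (\<lambda>x. u i x * u j x)"
    and m: "\<And>i j. m (i + j) = (LINT x|M. u i x * u j x)"
    and psd: "hankel_psd (\<lambda>k. fact k * fps_nth F k)"
  shows "hankel_psd (\<lambda>k. fact k * fps_nth (Abs_fps m * F) k)"
  unfolding hankel_psd_def
proof (intro allI)
  fix N :: nat and w :: "nat \<Rightarrow> real"
  define c where "c = (\<lambda>k. fact k * fps_nth F k)"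
  define A where "A = Sigma {..N} (\<lambda>p. {..p::nat})"
  \<comment> \<open>For fixed \<open>k\<close> and \<open>x\<close>, this vector collects everything
    that belongs to one pair \<open>(p, i)\<close>: its binomial weight and its factors in the Gram
    forms of \<open>fact (i + j)\<close> and \<open>m (i + j)\<close>. Only the Hankel entry of
    \<open>c\<close> then links two pairs.\<close>
  define v where "v k x = (\<lambda>(p, i). w p * real (p choose i) * (fact i * real (i choose k)) * u i x)" for k x
  define h where "h = (\<lambda>(p, i). p - i :: nat)"
  have [simp]: "finite A" by (simp add: A_def)
  have sum_A: "(\<Sum>p\<le>N. \<Sum>i\<le>p. f (p, i)) = (\<Sum>a\<in>A. f a)" for f :: "nat \<times> nat \<Rightarrow> real"
    unfolding A_def by (simp add: sum.Sigma split_def)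
  \<comment> \<open>The factorial weight turns the Cauchy product into a binomial convolution, which
    then splits over \<open>p\<close> and \<open>q\<close>.\<close>
  have expand: "fact (p + q) * fps_nth (Abs_fps m * F) (p + q)
     = (\<Sum>i\<le>p. \<Sum>j\<le>q. real (p choose i) * real (q choose j) * (fact (i + j) * m (i + j) * c (p - i + (q - j))))" for p q
  proof -
    have "fact (p + q) * fps_nth (Abs_fps m * F) (p + q)
        = (\<Sum>s\<le>p + q. real (p + q choose s) * (fact s * m s * c (p + q - s)))"
      unfolding fps_mult_nth sum_distrib_left c_def atLeast0AtMost
      by (intro sum.cong refl) (simp add: binomial_fact field_simps)
    also have "\<dots> = (\<Sum>i\<le>p. \<Sum>j\<le>q. real (p choose i) * real (q choose j) * (fact (i + j) * m (i + j) * c (p + q - (i + j))))"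
      by (rule sum_binomial_add)
    also have "\<dots> = (\<Sum>i\<le>p. \<Sum>j\<le>q. real (p choose i) * real (q choose j) * (fact (i + j) * m (i + j) * c (p - i + (q - j))))"
      by (intro sum.cong refl) (auto simp: algebra_simps)
    finally show ?thesis .
  qed
  have term_eq: "w p * w q * (real (p choose i) * real (q choose j) * (fact (i + j) * m (i + j) * c (p - i + (q - j))))
      = (\<Sum>k\<le>N. LINT x|M. v k x (p, i) * v k x (q, j) * c (h (p, i) + h (q, j)))"
    if "i \<le> N" for p q i j
  proof -
    have "(LINT x|M. v k x (p, i) * v k x (q, j) * c (h (p, i) + h (q, j)))
        = w p * w q * real (p choose i) * real (q choose j) * c (p - i + (q - j)) * m (i + j)
          * ((fact i * real (i choose k)) * (fact j * real (j choose k)))" for k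
    proof -
      have "(LINT x|M. v k x (p, i) * v k x (q, j) * c (h (p, i) + h (q, j)))
          = (LINT x|M. (w p * w q * real (p choose i) * real (q choose j) * c (p - i + (q - j))
             * ((fact i * real (i choose k)) * (fact j * real (j choose k)))) * (u i x * u j x))"
        unfolding v_def h_def by (intro Bochner_Integration.integral_cong refl) (simp add: algebra_simps)
      then show ?thesis by (simp add: m)
    qed
    then show ?thesis
      by (simp add: fact_add_gram[OF that] sum_distrib_left sum_distrib_right mult_ac)
  qed
  have int_v: "integrable M (\<lambda>x. v k x a * v k x b * z)" for k a b z
  proof -
    obtain p i q j where ab: "a = (p, i)" "b = (q, j)" by fastforce
    have "(\<lambda>x. v k x a * v k x b * z) = (\<lambda>x. (w p * real (p choose i) * (fact i * real (i choose k))
       * (w q * real (q choose j) * (fact j * real (j choose k))) * z) * (u i x * u j x))"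
      unfolding v_def ab by (auto simp: mult_ac)
    then show ?thesis using int by simp
  qed
  have "(\<Sum>p\<le>N. \<Sum>q\<le>N. w p * w q * (fact (p + q) * fps_nth (Abs_fps m * F) (p + q)))
      = (\<Sum>p\<le>N. \<Sum>q\<le>N. \<Sum>i\<le>p. \<Sum>j\<le>q. \<Sum>k\<le>N. LINT x|M. v k x (p, i) * v k x (q, j) * c (h (p, i) + h (q, j)))"
    unfolding expand sum_distrib_left by (intro sum.cong refl term_eq) auto
  also have "\<dots> = (\<Sum>p\<le>N. \<Sum>i\<le>p. \<Sum>q\<le>N. \<Sum>j\<le>q. \<Sum>k\<le>N. LINT x|M. v k x (p, i) * v k x (q, j) * c (h (p, i) + h (q, j)))"
    by (intro sum.cong refl sum.swap)
  also have "\<dots> = (\<Sum>a\<in>A. \<Sum>b\<in>A. \<Sum>k\<le>N. LINT x|M. v k x a * v k x b * c (h a + h b))"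
    by (simp only: sum_A[symmetric])
  \<comment> \<open>With \<open>k\<close> and then the integral moved outside, each \<open>k\<close>
    and \<open>x\<close> leaves a quadratic form of the Hankel matrix of \<open>c\<close>.\<close>
  also have "\<dots> = (\<Sum>k\<le>N. \<Sum>a\<in>A. \<Sum>b\<in>A. LINT x|M. v k x a * v k x b * c (h a + h b))"
    by (subst sum.swap, subst (2) sum.swap, subst (1) sum.swap) (rule sum.cong[OF refl], rule sum.swap)
  also have "\<dots> = (\<Sum>k\<le>N. LINT x|M. (\<Sum>a\<in>A. \<Sum>b\<in>A. v k x a * v k x b * c (h a + h b)))"
    using int_v by (simp add: Bochner_Integration.integral_sum integrable_sum)
  also have "0 \<le> \<dots>"
    using psd by (intro sum_nonneg Bochner_Integration.integral_nonneg hankel_psd_family) (auto simp: c_def)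
  finally show "0 \<le> (\<Sum>p\<le>N. \<Sum>q\<le>N. w p * w q * (fact (p + q) * fps_nth (Abs_fps m * F) (p + q)))" .
qed

text \<open>Induction on \<open>n\<close> multiplies in one factor at a time, starting from the
  series 1, which belongs to the constant variable 0. The even coefficient is a diagonal Hankel
  entry up to a positive factorial.\<close>

lemma fps_power_even_nth_nonneg:
  fixes m :: "nat \<Rightarrow> real"
  assumes "\<And>i j. integrable M (\<lambda>x. u i x * u j x)"
    and "\<And>i j. m (i + j) = (LINT x|M. u i x * u j x)"
  shows "0 \<le> fps_nth (Abs_fps m ^ n) (2 * j)"
proof -
  have "hankel_psd (\<lambda>k. fact k * fps_nth (Abs_fps m ^ n) k)"
  proof (induction n)
    case 0
    have "(\<Sum>p\<le>N. \<Sum>q\<le>N. w p * w q * (fact (p + q) * fps_nth 1 (p + q))) = w 0 * w 0"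
      for N and w :: "nat \<Rightarrow> real"
    proof -
      have "w p * w q * (fact (p + q) * fps_nth 1 (p + q))
          = (if p = 0 then if q = 0 then w 0 * w 0 else 0 else 0)" for p q
        by auto
      then show ?thesis
        by (subst sum.cong[OF refl, of _ _ "\<lambda>p. if p = 0 then w 0 * w 0 else 0"]) auto
    qed
    then show ?case by (simp add: hankel_psd_def)
  next
    case (Suc n)
    then show ?case
      by (simp add: hankel_psd_fps_mult[of M u m, OF assms])
  qed
  from hankel_psd_even_nonneg[OF this, of j] show ?thesis
    by (simp add: zero_le_mult_iff) (metis fact_gt_zero not_le)
qed

text \<open>The series on the left is G(-z), so its power is \<open>G ^ n\<close> at -z. On the
  operator side this is the passage from \<open>U\<close> to \<open>- U\<close>.\<close>

lemma fps_power_uminus_arg_nth: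
  fixes m :: "nat \<Rightarrow> 'a::comm_ring_1"
  shows "fps_nth (Abs_fps (\<lambda>k. (-1) ^ k * m k) ^ n) k = (-1) ^ k * fps_nth (Abs_fps m ^ n) k"
proof (induction n arbitrary: k)
  case (Suc n)
  have "(-1) ^ i * m i * ((-1) ^ (k - i) * c) = (-1) ^ k * (m i * c)" if "i \<le> k" for i c
  proof -
    have "(-1) ^ k = (-1) ^ i * (-1 :: 'a) ^ (k - i)"
      using that by (simp flip: power_add)
    then show ?thesis by (simp add: mult_ac)
  qed
  then show ?case
    by (simp add: fps_mult_nth Suc sum_distrib_left)
qed simp

text \<open>The exact coefficient is \<open>n * m 2\<close> plus \<open>n choose 2\<close> times the
  square of \<open>m 1\<close>; the square is dropped.\<close>

lemma fps_power_nth_2_ge: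
  fixes m :: "nat \<Rightarrow> real"
  assumes "m 0 = 1"
  shows "real n * m 2 \<le> fps_nth (Abs_fps m ^ n) 2"
proof -
  have nth0: "fps_nth (Abs_fps m ^ n) 0 = 1" for n
    using assms by (simp add: fps_power_zeroth)
  have nth1: "fps_nth (Abs_fps m ^ n) 1 = real n * m 1" for n
    by (induction n) (use nth0 assms in \<open>auto simp: fps_mult_nth algebra_simps\<close>)
  show ?thesis
  proof (induction n)
    case (Suc n)
    have "fps_nth (Abs_fps m ^ Suc n) 2 = fps_nth (Abs_fps m ^ n) 2 + m 1 * (real n * m 1) + m 2"
      using nth0[of n] nth1[of n] assms by (simp add: fps_mult_nth numeral_2_eq_2)
    moreover have "0 \<le> m 1 * (real n * m 1)"
      by (metis mult.left_commute of_nat_0_le_iff zero_le_mult_iff zero_le_square)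
    ultimately have "real n * m 2 + m 2 \<le> fps_nth (Abs_fps m ^ Suc n) 2"
      using Suc by linarith
    then show ?case
      by (simp add: algebra_simps)
  qed simp
qed

text \<open>In a product of factors \<open>J\<close> and \<open>U\<close>, the copies of
  \<open>J\<close> cut the word into \<open>r + 1\<close> blocks of total length
  \<open>L - r\<close>. A path with \<open>L\<close> edges has \<open>r\<close> copies and weight 1.
  A cycle with \<open>L + 1\<close> edges has \<open>r + 1\<close> copies and weight
  \<open>(L + 1) / (r + 1)\<close>, which accounts for rotations.\<close>

definition weighted_power_coeff :: "(nat \<Rightarrow> real) \<Rightarrow> nat \<Rightarrow> (nat \<Rightarrow> real) \<Rightarrow> real" where
  "weighted_power_coeff \<alpha> L m = (\<Sum>r\<le>L. \<alpha> r * fps_nth (Abs_fps m ^ Suc r) (L - r))"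

text \<open>Terms with \<open>L - r\<close> odd cancel, the others double and are nonnegative. The
  two terms kept are \<open>r = L\<close>, of degree 0, and \<open>r = L - 2\<close>, of degree 2 in
  the power \<open>L - 1\<close>.\<close>

lemma weighted_power_coeff_even_part_ge:
  assumes "\<And>n j. 0 \<le> fps_nth (Abs_fps m ^ n) (2 * j)" "m 0 = 1"
    and \<alpha>: "\<And>r. 0 \<le> \<alpha> r" and L: "2 \<le> L"
  shows "2 * \<alpha> L + 2 * \<alpha> (L - 2) * real (L - 1) * m 2
     \<le> weighted_power_coeff \<alpha> L m + weighted_power_coeff \<alpha> L (\<lambda>k. (-1) ^ k * m k)"
proof -
  define T where "T r = (1 + (-1) ^ (L - r)) * (\<alpha> r * fps_nth (Abs_fps m ^ Suc r) (L - r))" for r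
  have "weighted_power_coeff \<alpha> L m + weighted_power_coeff \<alpha> L (\<lambda>k. (-1) ^ k * m k) = (\<Sum>r\<le>L. T r)"
    unfolding weighted_power_coeff_def T_def fps_power_uminus_arg_nth
    by (simp add: sum.distrib algebra_simps)
  also have "\<dots> \<ge> (\<Sum>r\<in>{L, L - 2}. T r)"
  proof (rule sum_mono2)
    fix r
    show "0 \<le> T r"
    proof (cases "even (L - r)")
      case True
      then obtain j where "L - r = 2 * j" by (elim evenE)
      then show ?thesis unfolding T_def using assms(1)[of "Suc r" j] \<alpha>[of r] by simp
    qed (simp add: T_def)
  qed auto
  moreover have "T L = 2 * \<alpha> L"
    using \<open>m 0 = 1\<close> by (simp add: T_def fps_power_zeroth)
  moreover have "2 * \<alpha> (L - 2) * real (L - 1) * m 2 \<le> T (L - 2)"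
  proof -
    have "Suc (L - 2) = L - 1" "L - (L - 2) = 2" using L by auto
    then have "T (L - 2) = 2 * \<alpha> (L - 2) * fps_nth (Abs_fps m ^ (L - 1)) 2"
      by (simp add: T_def)
    then show ?thesis
      using fps_power_nth_2_ge[of m "L - 1"] \<open>m 0 = 1\<close> \<alpha>[of "L - 2"]
      by (simp add: mult_left_mono mult.assoc)
  qed
  ultimately show ?thesis using L by simp
qed

section \<open>Renewal identities for paths and cycles\<close>

lemma sum_triangle_swap:
  fixes f :: "nat \<Rightarrow> nat \<Rightarrow> 'a::comm_monoid_add"
  shows "(\<Sum>r\<le>n. \<Sum>i\<le>n - r. f r i) = (\<Sum>i\<le>n. \<Sum>r\<le>n - i. f r i)"
  by (simp add: sum.Sigma)
     (rule sum.reindex_bij_witness[of _ prod.swap prod.swap], auto)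

text \<open>As series, P = G + z P G, so P = G / (1 - z G), which is the sum of all z^r G^(r + 1).
  The strong induction peels off one factor G.\<close>

lemma renewal_eq_weighted_power_coeff:
  assumes p: "\<And>n. p n = m n + (\<Sum>i<n. p (n - 1 - i) * m i)"
  shows "p n = weighted_power_coeff (\<lambda>_. 1) n m"
proof (induction n rule: less_induct)
  case (less n)
  show ?case
  proof (cases n)
    case 0
    then show ?thesis using p[of 0] by (simp add: weighted_power_coeff_def)
  next
    case (Suc l)
    let ?G = "Abs_fps m"
    have "p n = m n + (\<Sum>i\<le>l. p (l - i) * m i)"
      using p[of n] Suc by (simp add: lessThan_Suc_atMost)
    also have "(\<Sum>i\<le>l. p (l - i) * m i) = (\<Sum>i\<le>l. \<Sum>r\<le>l - i. m i * fps_nth (?G ^ Suc r) (l - i - r))"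
    proof (intro sum.cong refl)
      fix i
      have "p (l - i) = weighted_power_coeff (\<lambda>_. 1) (l - i) m"
        using Suc by (intro less) auto
      then show "p (l - i) * m i = (\<Sum>r\<le>l - i. m i * fps_nth (?G ^ Suc r) (l - i - r))"
        by (simp add: weighted_power_coeff_def sum_distrib_left mult.commute)
    qed
    also have "\<dots> = (\<Sum>r\<le>l. \<Sum>i\<le>l - r. m i * fps_nth (?G ^ Suc r) (l - i - r))"
      by (rule sum_triangle_swap)
    also have "\<dots> = (\<Sum>r\<le>l. fps_nth (?G * ?G ^ Suc r) (l - r))"
      unfolding fps_mult_nth atLeast0AtMost
      by (intro sum.cong refl) (simp add: diff_right_commute add.commute)
    also have "m n + \<dots> = weighted_power_coeff (\<lambda>_. 1) n m"
      unfolding weighted_power_coeff_def Suc by (subst sum.atMost_Suc_shift) simp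
    finally show ?thesis .
  qed
qed

text \<open>This compares coefficients in the derivative of \<open>(X * G) ^ Suc s\<close>.\<close>
lemma fps_power_Suc_nth_deriv:
  fixes G :: "'a::comm_ring_1 fps"
  shows "of_nat (Suc s) * (\<Sum>e\<le>N. of_nat (Suc (N - e)) * fps_nth G (N - e) * fps_nth (G ^ s) e)
       = of_nat (N + Suc s) * fps_nth (G ^ Suc s) N"
proof -
  have "of_nat (N + Suc s) * fps_nth (G ^ Suc s) N = fps_nth (fps_deriv ((fps_X * G) ^ Suc s)) (N + s)"
    by (simp only: fps_deriv_nth power_mult_distrib fps_X_power_mult_nth) simp
  also have "fps_deriv ((fps_X * G) ^ Suc s) = of_nat (Suc s) * (fps_X ^ s * (fps_deriv (fps_X * G) * G ^ s))"
    by (subst fps_deriv_power') (simp add: power_mult_distrib mult_ac)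
  also have "fps_nth \<dots> (N + s) = of_nat (Suc s) * fps_nth (G ^ s * fps_deriv (fps_X * G)) N"
    by (simp only: fps_of_nat[symmetric] fps_mult_left_const_nth fps_X_power_mult_nth) (simp add: mult.commute)
  also have "fps_nth (G ^ s * fps_deriv (fps_X * G)) N
      = (\<Sum>e\<le>N. of_nat (Suc (N - e)) * fps_nth G (N - e) * fps_nth (G ^ s) e)"
    unfolding fps_mult_nth atLeast0AtMost
    by (intro sum.cong refl) (simp only: fps_deriv_nth, simp add: mult_ac)
  finally show ?thesis by simp
qed

lemma sum_sum_lessThan:
  fixes f :: "nat \<Rightarrow> real"
  shows "(\<Sum>a\<le>n. \<Sum>d<a. f d) = (\<Sum>d<n. real (n - d) * f d)"
proof (induction n)
  case (Suc n)
  have "(\<Sum>d<n. real (Suc n - d) * f d) = (\<Sum>d<n. real (n - d) * f d) + (\<Sum>d<n. f d)"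
    unfolding sum.distrib[symmetric]
    by (intro sum.cong refl) (simp add: Suc_diff_le algebra_simps)
  then show ?case using Suc by simp
qed simp

text \<open>With P = G / (1 - z G), the left side is the coefficient of z^l in (z G)' (1 + z P) = (z
  G)' / (1 - z G), the derivative of -log(1 - z G). The weights come from expanding the
  logarithm.\<close>

lemma cyclic_renewal_eq_weighted_power_coeff:
  assumes p: "\<And>n. p n = weighted_power_coeff (\<lambda>_. 1) n m"
  shows "(\<Sum>a\<le>l. m l + (\<Sum>d<a. p d * m (l - 1 - d)))
       = weighted_power_coeff (\<lambda>r. real (Suc l) / real (Suc r)) l m"
proof (cases l)
  case 0
  then show ?thesis by (simp add: weighted_power_coeff_def)
next
  case (Suc n)
  let ?G = "Abs_fps m"
  \<comment> \<open>The index \<open>d\<close> occurs once for each \<open>a\<close> from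
    \<open>d + 1\<close> to \<open>l\<close>, that is, \<open>l - d\<close> times.\<close>
  have "(\<Sum>a\<le>l. \<Sum>d<a. p d * m (l - 1 - d)) = (\<Sum>d\<le>n. real (Suc (n - d)) * (p d * m (n - d)))"
    unfolding sum_sum_lessThan using Suc
    by (intro sum.cong) (auto simp: Suc_diff_le)
  also have "\<dots> = (\<Sum>d\<le>n. \<Sum>r\<le>d. real (Suc (n - d)) * m (n - d) * fps_nth (?G ^ Suc r) (d - r))"
    unfolding p weighted_power_coeff_def
    by (rule sum.cong[OF refl]) (simp add: sum_distrib_left sum_distrib_right mult_ac)
  also have "\<dots> = (\<Sum>r\<le>n. \<Sum>e\<le>n - r. real (Suc (n - r - e)) * m (n - r - e) * fps_nth (?G ^ Suc r) e)"
    by (simp add: sum.Sigma)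
      (rule sum.reindex_bij_witness[of _ "\<lambda>(r, e). (r + e, r)" "\<lambda>(d, r). (r, d - r)"], auto)
  \<comment> \<open>The derivative identity is used with \<open>s = Suc r\<close> and
    \<open>N = n - r\<close>, for which \<open>N + Suc s\<close> is \<open>Suc l\<close>.\<close>
  also have "\<dots> = (\<Sum>r\<le>n. real (Suc l) / real (Suc (Suc r)) * fps_nth (?G ^ Suc (Suc r)) (n - r))"
  proof (intro sum.cong refl)
    fix r assume "r \<in> {..n}"
    then have "n - r + Suc (Suc r) = Suc l" using Suc by simp
    then show "(\<Sum>e\<le>n - r. real (Suc (n - r - e)) * m (n - r - e) * fps_nth (?G ^ Suc r) e)
        = real (Suc l) / real (Suc (Suc r)) * fps_nth (?G ^ Suc (Suc r)) (n - r)"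
      using fps_power_Suc_nth_deriv[of "Suc r" "n - r" ?G]
      by (simp add: field_simps del: of_nat_Suc power_Suc)
  qed
  finally have "(\<Sum>a\<le>l. m l + (\<Sum>d<a. p d * m (l - 1 - d)))
      = real (Suc l) * m l + (\<Sum>r\<le>n. real (Suc l) / real (Suc (Suc r)) * fps_nth (?G ^ Suc (Suc r)) (n - r))"
    by (simp add: sum.distrib)
  also have "\<dots> = weighted_power_coeff (\<lambda>r. real (Suc l) / real (Suc r)) l m"
    unfolding weighted_power_coeff_def Suc
    by (subst sum.atMost_Suc_shift) (simp del: of_nat_Suc power_Suc)
  finally show ?thesis .
qed

section \<open>Integral operators of bounded kernels\<close>

text \<open>The bound holds at every point of the space, not only almost everywhere. Every section
  of a bounded kernel is then integrable, and operator identities can be stated pointwise.\<close>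

definition bounded_fun :: "'a measure \<Rightarrow> ('a \<Rightarrow> real) \<Rightarrow> bool" where
  "bounded_fun M f \<longleftrightarrow> f \<in> borel_measurable M \<and> (\<exists>B. \<forall>x\<in>space M. \<bar>f x\<bar> \<le> B)"

lemma bounded_funE:
  assumes "bounded_fun M f"
  obtains B where "0 \<le> B" "\<And>x. x \<in> space M \<Longrightarrow> \<bar>f x\<bar> \<le> B"
proof -
  obtain B where B: "\<forall>x\<in>space M. \<bar>f x\<bar> \<le> B"
    using assms by (auto simp: bounded_fun_def)
  have "\<bar>f x\<bar> \<le> \<bar>B\<bar>" if "x \<in> space M" for x
    using B that by (meson abs_ge_self order_trans)
  then show ?thesis using that[of "\<bar>B\<bar>"] by simp
qed

lemma bounded_fun_const: "bounded_fun M (\<lambda>_. c)"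
  by (auto simp: bounded_fun_def)

lemma bounded_fun_add:
  assumes "bounded_fun M f" "bounded_fun M g"
  shows "bounded_fun M (\<lambda>x. f x + g x)"
proof -
  obtain B C where "\<And>x. x \<in> space M \<Longrightarrow> \<bar>f x\<bar> \<le> B" "\<And>x. x \<in> space M \<Longrightarrow> \<bar>g x\<bar> \<le> C"
    using assms by (metis bounded_funE)
  then have "\<forall>x\<in>space M. \<bar>f x + g x\<bar> \<le> B + C"
    by (metis abs_triangle_ineq add_mono order_trans)
  then show ?thesis using assms by (auto simp: bounded_fun_def)
qed

lemma bounded_fun_mult:
  assumes "bounded_fun M f" "bounded_fun M g"
  shows "bounded_fun M (\<lambda>x. f x * g x)"
proof -
  obtain B C where "0 \<le> B" "\<And>x. x \<in> space M \<Longrightarrow> \<bar>f x\<bar> \<le> B" "\<And>x. x \<in> space M \<Longrightarrow> \<bar>g x\<bar> \<le> C"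
    using assms by (metis bounded_funE)
  then have "\<forall>x\<in>space M. \<bar>f x * g x\<bar> \<le> B * C"
    by (simp add: abs_mult mult_mono)
  then show ?thesis using assms by (auto simp: bounded_fun_def)
qed

lemma bounded_fun_prod:
  assumes "\<And>i. i \<in> I \<Longrightarrow> bounded_fun M (f i)"
  shows "bounded_fun M (\<lambda>x. \<Prod>i\<in>I. f i x)"
  using assms by (induction I rule: infinite_finite_induct) (auto intro: bounded_fun_const bounded_fun_mult)

lemma bounded_fun_compose:
  assumes "bounded_fun M g" "f \<in> measurable N M"
  shows "bounded_fun N (\<lambda>x. g (f x))"
  using assms measurable_space[OF assms(2)]
  by (auto simp: bounded_fun_def intro: measurable_compose)

lemma bounded_fun_compose2:
  assumes "bounded_fun (M1 \<Otimes>\<^sub>M M2) (case_prod K)" "f \<in> measurable N M1" "g \<in> measurable N M2"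
  shows "bounded_fun N (\<lambda>x. K (f x) (g x))"
  using bounded_fun_compose[OF assms(1) measurable_Pair[OF assms(2,3)]] by simp

lemma (in finite_measure) bounded_fun_integrable:
  assumes "bounded_fun M f"
  shows "integrable M f"
proof -
  obtain B where "\<And>x. x \<in> space M \<Longrightarrow> \<bar>f x\<bar> \<le> B"
    using assms by (metis bounded_funE)
  then show ?thesis
    using assms by (intro integrable_const_bound[of f B]) (auto simp: bounded_fun_def)
qed

lemma (in finite_measure) integral_add_lincomb:
  assumes "bounded_fun M f" "\<And>i. i \<in> I \<Longrightarrow> bounded_fun M (h i)"
  shows "(\<integral>x. f x + (\<Sum>i\<in>I. c i * h i x) \<partial>M) = (\<integral>x. f x \<partial>M) + (\<Sum>i\<in>I. c i * (\<integral>x. h i x \<partial>M))"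
proof -
  have "integrable M (\<lambda>x. c i * h i x)" if "i \<in> I" for i
    using assms(2)[OF that] by (intro bounded_fun_integrable bounded_fun_mult bounded_fun_const)
  then have "(\<integral>x. f x + (\<Sum>i\<in>I. c i * h i x) \<partial>M) = (\<integral>x. f x \<partial>M) + (\<Sum>i\<in>I. \<integral>x. c i * h i x \<partial>M)"
    using bounded_fun_integrable[OF assms(1)]
    by (subst Bochner_Integration.integral_add) (auto intro: Bochner_Integration.integral_sum)
  then show ?thesis by simp
qed

lemma (in prob_space) bounded_fun_integral:
  assumes "bounded_fun (N \<Otimes>\<^sub>M M) (case_prod f)"
  shows "bounded_fun N (\<lambda>x. \<integral>y. f x y \<partial>M)"
proof -
  obtain B where B: "\<And>x. x \<in> space (N \<Otimes>\<^sub>M M) \<Longrightarrow> \<bar>case_prod f x\<bar> \<le> B"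
    using assms by (metis bounded_funE)
  have "\<bar>\<integral>y. f x y \<partial>M\<bar> \<le> B" if x: "x \<in> space N" for x
  proof -
    have "bounded_fun M (\<lambda>y. f x y)"
      using bounded_fun_compose2[OF assms, of "\<lambda>_. x" M "\<lambda>y. y"] x by simp
    then have int: "integrable M (f x)" by (rule bounded_fun_integrable)
    have *: "\<bar>f x y\<bar> \<le> B" if "y \<in> space M" for y
      using B[of "(x, y)"] x that by (simp add: space_pair_measure)
    have "\<bar>\<integral>y. f x y \<partial>M\<bar> \<le> (\<integral>y. \<bar>f x y\<bar> \<partial>M)" by (rule integral_abs_bound)
    also have "\<dots> \<le> B"
      using int * by (intro integral_le_const) auto
    finally show ?thesis .
  qed
  then show ?thesis
    using assms unfolding bounded_fun_def by (auto intro: borel_measurable_lebesgue_integral)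
qed

lemma (in prob_space) bounded_fun_Fubini:
  assumes "bounded_fun (M \<Otimes>\<^sub>M M) (case_prod f)"
  shows "(\<integral>y. (\<integral>x. f x y \<partial>M) \<partial>M) = (\<integral>x. (\<integral>y. f x y \<partial>M) \<partial>M)"
proof -
  interpret P: pair_prob_space M M ..
  show ?thesis
    using assms by (intro P.Fubini_integral P.bounded_fun_integrable)
qed

section \<open>Iterates of an integral operator\<close>

definition kop :: "'a measure \<Rightarrow> ('a \<Rightarrow> 'a \<Rightarrow> real) \<Rightarrow> ('a \<Rightarrow> real) \<Rightarrow> 'a \<Rightarrow> real" where
  "kop M K f x = (\<integral>y. K x y * f y \<partial>M)"

lemma kop_power_cmult: "(kop M (\<lambda>x y. c * K x y) ^^ n) f = (\<lambda>x. c ^ n * (kop M K ^^ n) f x)"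
  by (induction n) (auto simp: kop_def fun_eq_iff mult_ac simp flip: integral_mult_right_zero)

lemma kop_power_cmult_arg: "(kop M K ^^ n) (\<lambda>y. c * f y) = (\<lambda>x. c * (kop M K ^^ n) f x)"
  by (induction n) (auto simp: kop_def fun_eq_iff mult_ac simp flip: integral_mult_right_zero)

text \<open>The trace of the operator to the power \<open>l + 1\<close>, not \<open>l\<close>.\<close>
definition kop_trace :: "'a measure \<Rightarrow> ('a \<Rightarrow> 'a \<Rightarrow> real) \<Rightarrow> nat \<Rightarrow> real" where
  "kop_trace M K l = (\<integral>x. (kop M K ^^ l) (\<lambda>y. K y x) x \<partial>M)"

lemma kop_trace_cmult: "kop_trace M (\<lambda>x y. c * K x y) l = c ^ Suc l * kop_trace M K l"
  by (simp add: kop_trace_def kop_power_cmult kop_power_cmult_arg mult_ac)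

locale bounded_kernel = prob_space M for M :: "'a measure" +
  fixes K :: "'a \<Rightarrow> 'a \<Rightarrow> real"
  assumes bounded: "bounded_fun (M \<Otimes>\<^sub>M M) (case_prod K)"
begin

text \<open>The parameter provides joint measurability. Traces and closed walks need it because
  there the starting function depends on the point at which the iterate is evaluated.\<close>

lemma kop_bounded_param:
  assumes "bounded_fun (N \<Otimes>\<^sub>M M) (case_prod g)"
  shows "bounded_fun (N \<Otimes>\<^sub>M M) (\<lambda>(a, x). kop M K (g a) x)"
proof -
  have "bounded_fun ((N \<Otimes>\<^sub>M M) \<Otimes>\<^sub>M M) (\<lambda>p. K (snd (fst p)) (snd p) * g (fst (fst p)) (snd p))"
    by (intro bounded_fun_mult bounded_fun_compose2[OF bounded] bounded_fun_compose2[OF assms]) measurable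
  then show ?thesis
    using bounded_fun_integral[of "N \<Otimes>\<^sub>M M" "\<lambda>p y. K (snd p) y * g (fst p) y"]
    by (simp add: kop_def split_def)
qed

lemma kop_power_bounded_param:
  assumes "bounded_fun (N \<Otimes>\<^sub>M M) (case_prod g)"
  shows "bounded_fun (N \<Otimes>\<^sub>M M) (\<lambda>(a, x). (kop M K ^^ n) (g a) x)"
proof (induction n)
  case (Suc n)
  show ?case using kop_bounded_param[OF Suc] by simp
qed (use assms in simp)

lemma kop_power_bounded:
  assumes "bounded_fun M f"
  shows "bounded_fun M ((kop M K ^^ n) f)"
proof (cases "space M = {}")
  case False
  then obtain a where a: "a \<in> space M" by auto
  have "bounded_fun (M \<Otimes>\<^sub>M M) (case_prod (\<lambda>_. f))"
    using bounded_fun_compose[OF assms measurable_snd] by (simp add: split_def)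
  then have "bounded_fun (M \<Otimes>\<^sub>M M) (case_prod (\<lambda>_. (kop M K ^^ n) f))"
    using kop_power_bounded_param[of M "\<lambda>_. f" n] by simp
  from bounded_fun_compose2[OF this, of "\<lambda>_. a" M "\<lambda>x. x"] a show ?thesis
    by (simp only: measurable_const measurable_ident_sets simp_thms)
qed (use not_empty in simp)

lemma kop_bounded:
  assumes "bounded_fun M f"
  shows "bounded_fun M (kop M K f)"
  using kop_power_bounded[OF assms, of "Suc 0"] by (simp only: funpow.simps comp_id)

lemma section_bounded: "x \<in> space M \<Longrightarrow> bounded_fun M (K x)"
  by (rule bounded_fun_compose2[OF bounded, of "\<lambda>_. x" M "\<lambda>y. y"]) auto

lemma section'_bounded: "y \<in> space M \<Longrightarrow> bounded_fun M (\<lambda>x. K x y)"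
  by (rule bounded_fun_compose2[OF bounded, of "\<lambda>x. x" M "\<lambda>_. y"]) auto

lemma kop_lincomb:
  assumes "x \<in> space M" "bounded_fun M f" "\<And>i. i \<in> I \<Longrightarrow> bounded_fun M (h i)"
    and "\<And>y. y \<in> space M \<Longrightarrow> g y = f y + (\<Sum>i\<in>I. c i * h i y)"
  shows "kop M K g x = kop M K f x + (\<Sum>i\<in>I. c i * kop M K (h i) x)"
proof -
  have "kop M K g x = (\<integral>y. K x y * f y + (\<Sum>i\<in>I. c i * (K x y * h i y)) \<partial>M)"
    unfolding kop_def using assms(4)
    by (intro Bochner_Integration.integral_cong refl) (simp add: algebra_simps sum_distrib_left)
  also have "\<dots> = (\<integral>y. K x y * f y \<partial>M) + (\<Sum>i\<in>I. c i * (\<integral>y. K x y * h i y \<partial>M))"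
    using assms section_bounded[OF assms(1)]
    by (intro integral_add_lincomb bounded_fun_mult)
  finally show ?thesis by (simp add: kop_def)
qed

lemma kop_power_add:
  assumes "x \<in> space M" "bounded_fun M f" "bounded_fun M g"
  shows "(kop M K ^^ n) (\<lambda>y. f y + g y) x = (kop M K ^^ n) f x + (kop M K ^^ n) g x"
  using assms(1)
proof (induction n arbitrary: x)
  case (Suc n)
  then show ?case
    using kop_lincomb[OF Suc.prems kop_power_bounded[OF assms(2)], where I = "{()}"
        and h = "\<lambda>_. (kop M K ^^ n) g" and g = "(kop M K ^^ n) (\<lambda>y. f y + g y)" and c = "\<lambda>_. 1"]
      kop_power_bounded[OF assms(3)]
    by simp
qed simp

lemma kop_plus_one:
  assumes "x \<in> space M" "bounded_fun M f"
  shows "kop M (\<lambda>x y. 1 + K x y) f x = (\<integral>y. f y \<partial>M) + kop M K f x"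
  using section_bounded[OF assms(1)] assms unfolding kop_def
  by (simp add: distrib_right bounded_fun_integrable bounded_fun_mult)

lemma plus_one: "bounded_kernel M (\<lambda>x y. 1 + K x y)"
proof unfold_locales
  show "bounded_fun (M \<Otimes>\<^sub>M M) (\<lambda>(x, y). 1 + K x y)"
    using bounded_fun_add[OF bounded_fun_const bounded, of 1] by (simp add: split_def)
qed

text \<open>Let \<open>J\<close> be the kernel 1 and \<open>U\<close> the kernel \<open>K\<close>.
  Sorting the words of (J + U)^n by their leftmost \<open>J\<close> gives the terms U^i J (J + U)^(n
  - 1 - i). Since \<open>J\<close> sends a function to its integral, each term is a scalar times U^i
  1.\<close>

lemma kop_plus_one_power:
  assumes f: "bounded_fun M f" and "x \<in> space M"
  shows "(kop M (\<lambda>x y. 1 + K x y) ^^ n) f x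
    = (kop M K ^^ n) f x
      + (\<Sum>i<n. (\<integral>y. (kop M (\<lambda>x y. 1 + K x y) ^^ (n - 1 - i)) f y \<partial>M) * (kop M K ^^ i) (\<lambda>_. 1) x)"
  using \<open>x \<in> space M\<close>
proof (induction n arbitrary: x)
  case (Suc n)
  interpret A: bounded_kernel M "\<lambda>x y. 1 + K x y" by (rule plus_one)
  let ?A = "kop M (\<lambda>x y. 1 + K x y)"
  have "(?A ^^ Suc n) f x = (\<integral>y. (?A ^^ n) f y \<partial>M) + kop M K ((?A ^^ n) f) x"
    using Suc.prems A.kop_power_bounded[OF f] by (simp add: kop_plus_one)
  also have "kop M K ((?A ^^ n) f) x = kop M K ((kop M K ^^ n) f) x
      + (\<Sum>i<n. (\<integral>y. (?A ^^ (n - 1 - i)) f y \<partial>M) * kop M K ((kop M K ^^ i) (\<lambda>_. 1)) x)"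
    using Suc by (intro kop_lincomb kop_power_bounded f bounded_fun_const) auto
  finally show ?case
    by (simp add: sum.lessThan_Suc_shift del: sum.lessThan_Suc)
qed simp

text \<open>Integrating out the last vertex applies the operator to \<open>g\<close> in its second
  argument. The constant \<open>g = 1\<close> gives paths, and \<open>g a b = K b a\<close> closes
  the walk to a cycle.\<close>

lemma PiM_walk_integral:
  assumes "bounded_fun (M \<Otimes>\<^sub>M M) (case_prod g)"
  shows "(\<integral>x. (\<Prod>i<k. K (x i) (x (Suc i))) * g (x 0) (x k) \<partial>PiM {..k} (\<lambda>_. M))
       = (\<integral>x. (kop M K ^^ k) (g x) x \<partial>M)"
  using assms
proof (induction k arbitrary: g)
  case 0
  interpret P: product_sigma_finite "\<lambda>_::nat. M" ..
  have "(\<lambda>x. g x x) \<in> borel_measurable M"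
    using bounded_fun_compose2[OF 0, of "\<lambda>x. x" M "\<lambda>x. x"] by (auto simp: bounded_fun_def)
  then show ?case
    using P.product_integral_singleton[of "\<lambda>x. g x x" 0] by (simp add: atMost_0)
next
  case (Suc k)
  interpret P: product_sigma_finite "\<lambda>_::nat. M" ..
  let ?f = "\<lambda>x. (\<Prod>i<Suc k. K (x i) (x (Suc i))) * g (x 0) (x (Suc k))"
  interpret Q: prob_space "PiM {..Suc k} (\<lambda>_. M)"
    by (intro prob_space_PiM prob_space_axioms)
  have "bounded_fun (PiM {..Suc k} (\<lambda>_. M)) ?f"
    by (intro bounded_fun_mult bounded_fun_prod bounded_fun_compose2[OF bounded]
        bounded_fun_compose2[OF Suc.prems]) auto
  then have "integrable (PiM (insert (Suc k) {..k}) (\<lambda>_. M)) ?f"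
    unfolding atMost_Suc[symmetric] by (rule Q.bounded_fun_integrable)
  then have "(\<integral>x. ?f x \<partial>PiM {..Suc k} (\<lambda>_. M))
      = (\<integral>x. \<integral>y. ?f (x(Suc k := y)) \<partial>M \<partial>PiM {..k} (\<lambda>_. M))"
    unfolding atMost_Suc by (intro P.product_integral_insert) auto
  also have "\<dots> = (\<integral>x. (\<Prod>i<k. K (x i) (x (Suc i))) * kop M K (g (x 0)) (x k) \<partial>PiM {..k} (\<lambda>_. M))"
    unfolding kop_def integral_mult_right_zero[symmetric]
    by (intro Bochner_Integration.integral_cong refl) (auto simp: mult_ac intro!: prod.cong)
  also have "\<dots> = (\<integral>x. (kop M K ^^ k) (kop M K (g x)) x \<partial>M)"
    by (rule Suc.IH[OF kop_bounded_param[OF Suc.prems]])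
  finally show ?case by (simp add: funpow_swap1)
qed

end

section \<open>Symmetric kernels, their moments and traces\<close>

locale sym_kernel = bounded_kernel +
  assumes sym: "x \<in> space M \<Longrightarrow> y \<in> space M \<Longrightarrow> K x y = K y x"
begin

lemma kop_self_adjoint:
  assumes f: "bounded_fun M f" and g: "bounded_fun M g"
  shows "(\<integral>x. f x * kop M K g x \<partial>M) = (\<integral>x. kop M K f x * g x \<partial>M)"
proof -
  have "bounded_fun (M \<Otimes>\<^sub>M M) (\<lambda>p. K (fst p) (snd p) * f (snd p) * g (fst p))"
    by (intro bounded_fun_mult bounded_fun_compose2[OF bounded] bounded_fun_compose[OF f] bounded_fun_compose[OF g])
      measurable
  then have B: "bounded_fun (M \<Otimes>\<^sub>M M) (\<lambda>(x, y). K x y * f y * g x)"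
    by (simp add: split_def)
  have "(\<integral>x. f x * kop M K g x \<partial>M) = (\<integral>y. (\<integral>x. K x y * f y * g x \<partial>M) \<partial>M)"
    unfolding kop_def integral_mult_right_zero[symmetric]
    by (intro Bochner_Integration.integral_cong refl) (auto simp: mult_ac sym)
  also have "\<dots> = (\<integral>x. (\<integral>y. K x y * f y * g x \<partial>M) \<partial>M)"
    by (rule bounded_fun_Fubini[OF B])
  finally show ?thesis by (simp add: kop_def)
qed

lemma kop_power_self_adjoint:
  assumes "bounded_fun M f" "bounded_fun M g"
  shows "(\<integral>x. f x * (kop M K ^^ n) g x \<partial>M) = (\<integral>x. (kop M K ^^ n) f x * g x \<partial>M)"
  using assms(2)
proof (induction n arbitrary: g)
  case (Suc n)
  have "(\<integral>x. f x * (kop M K ^^ Suc n) g x \<partial>M) = (\<integral>x. (kop M K ^^ n) f x * kop M K g x \<partial>M)"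
    using Suc.IH[OF kop_bounded[OF Suc.prems]] by (simp only: funpow_Suc_right o_apply)
  also have "\<dots> = (\<integral>x. kop M K ((kop M K ^^ n) f) x * g x \<partial>M)"
    by (intro kop_self_adjoint kop_power_bounded assms Suc.prems)
  finally show ?case by simp
qed simp

abbreviation iter_one :: "nat \<Rightarrow> 'a \<Rightarrow> real" where
  "iter_one n \<equiv> (kop M K ^^ n) (\<lambda>_. 1)"

definition moment :: "nat \<Rightarrow> real" where
  "moment n = (\<integral>x. iter_one n x \<partial>M)"

lemma iter_one_bounded: "bounded_fun M (iter_one n)"
  by (intro kop_power_bounded bounded_fun_const)

lemma moment_0: "moment 0 = 1"
  by (simp add: moment_def prob_space)

text \<open>Self-adjointness moves \<open>i\<close> iterations to the other factor. This is the Gram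
  representation behind the Hankel positivity.\<close>

lemma moment_add: "moment (i + j) = (\<integral>x. iter_one i x * iter_one j x \<partial>M)"
proof -
  have "moment (i + j) = (\<integral>x. 1 * (kop M K ^^ i) (iter_one j) x \<partial>M)"
    by (simp add: moment_def funpow_add)
  also have "\<dots> = (\<integral>x. iter_one i x * iter_one j x \<partial>M)"
    by (intro kop_power_self_adjoint bounded_fun_const iter_one_bounded)
  finally show ?thesis .
qed

lemma moment_power_even_nth_nonneg: "0 \<le> fps_nth (Abs_fps moment ^ n) (2 * j)"
  by (intro fps_power_even_nth_nonneg[where u = iter_one, OF _ moment_add]
      bounded_fun_integrable bounded_fun_mult iter_one_bounded)

abbreviation iter_one_plus :: "nat \<Rightarrow> 'a \<Rightarrow> real" where
  "iter_one_plus n \<equiv> (kop M (\<lambda>x y. 1 + K x y) ^^ n) (\<lambda>_. 1)"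

lemma plus_one_sym: "sym_kernel M (\<lambda>x y. 1 + K x y)"
  using plus_one by (simp add: sym_kernel_def sym_kernel_axioms_def sym)

text \<open>The case \<open>b = 0\<close> is the renewal recursion for paths. General
  \<open>b\<close> arises when a cycle is cut open at a copy of \<open>J\<close>.\<close>

lemma iter_one_plus_inner:
  "(\<integral>x. iter_one_plus a x * iter_one b x \<partial>M)
     = moment (a + b) + (\<Sum>j<a. (\<integral>x. iter_one_plus (a - 1 - j) x \<partial>M) * moment (j + b))"
proof -
  have "(\<integral>x. iter_one_plus a x * iter_one b x \<partial>M)
      = (\<integral>x. iter_one a x * iter_one b x
          + (\<Sum>j<a. (\<integral>x. iter_one_plus (a - 1 - j) x \<partial>M) * (iter_one j x * iter_one b x)) \<partial>M)"
    by (intro Bochner_Integration.integral_cong refl)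
       (simp add: kop_plus_one_power[OF bounded_fun_const] distrib_right sum_distrib_right mult.assoc)
  also have "\<dots> = (\<integral>x. iter_one a x * iter_one b x \<partial>M)
      + (\<Sum>j<a. (\<integral>x. iter_one_plus (a - 1 - j) x \<partial>M) * (\<integral>x. iter_one j x * iter_one b x \<partial>M))"
    by (intro integral_add_lincomb bounded_fun_mult iter_one_bounded)
  finally show ?thesis by (simp add: moment_add)
qed

lemma iter_one_plus_integral:
  "(\<integral>x. iter_one_plus n x \<partial>M) = weighted_power_coeff (\<lambda>_. 1) n moment"
proof (rule renewal_eq_weighted_power_coeff)
  fix n
  show "(\<integral>x. iter_one_plus n x \<partial>M)
      = moment n + (\<Sum>i<n. (\<integral>x. iter_one_plus (n - 1 - i) x \<partial>M) * moment i)"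
    using iter_one_plus_inner[of n 0] by simp
qed

text \<open>With A = J + U, the difference A^(l + 1) - U^(l + 1) telescopes into the terms U^i J
  A^(l - i) for i up to l. Each has rank one, and its trace is the inner product of
  \<open>iter_one_plus (l - i)\<close> and \<open>iter_one i\<close>.\<close>

lemma kop_trace_plus_one:
  "kop_trace M (\<lambda>x y. 1 + K x y) l
     = kop_trace M K l + weighted_power_coeff (\<lambda>r. real (Suc l) / real (Suc r)) l moment"
proof -
  let ?A = "kop M (\<lambda>x y. 1 + K x y)"
  interpret A: sym_kernel M "\<lambda>x y. 1 + K x y" by (rule plus_one_sym)
  define p where "p n = (\<integral>x. iter_one_plus n x \<partial>M)" for n
  have diag_bounded: "bounded_fun M (\<lambda>x. (kop M K ^^ l) (\<lambda>y. K y x) x)"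
  proof -
    have "bounded_fun (M \<Otimes>\<^sub>M M) (\<lambda>(x, y). K y x)"
      using bounded_fun_compose2[OF bounded measurable_snd measurable_fst] by (simp add: split_def)
    from bounded_fun_compose2[OF kop_power_bounded_param[OF this, of l], of "\<lambda>x. x" M "\<lambda>x. x"]
    show ?thesis by simp
  qed
  have diag: "(?A ^^ l) (\<lambda>y. 1 + K y x) x
      = (kop M K ^^ l) (\<lambda>y. K y x) x + (\<Sum>i\<le>l. iter_one_plus (l - i) x * iter_one i x)"
    if x: "x \<in> space M" for x
  proof -
    \<comment> \<open>Self-adjointness and symmetry turn the integral of an iterated section into
      one further iterate of 1, evaluated at \<open>x\<close>.\<close>
    have int: "(\<integral>y. (?A ^^ n) (\<lambda>y. 1 + K y x) y \<partial>M) = iter_one_plus (Suc n) x" for n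
    proof -
      have "(\<integral>y. (?A ^^ n) (\<lambda>y. 1 + K y x) y \<partial>M) = (\<integral>y. 1 * (?A ^^ n) (\<lambda>y. 1 + K y x) y \<partial>M)"
        by simp
      also have "\<dots> = (\<integral>y. iter_one_plus n y * (1 + K y x) \<partial>M)"
        by (intro A.kop_power_self_adjoint bounded_fun_const A.section'_bounded x)
      also have "\<dots> = (\<integral>y. (1 + K x y) * iter_one_plus n y \<partial>M)"
        by (intro Bochner_Integration.integral_cong refl) (simp add: sym x mult.commute)
      finally show ?thesis by (simp add: kop_def[of M "\<lambda>x y. 1 + K x y" "iter_one_plus n"])
    qed
    have "(?A ^^ l) (\<lambda>y. 1 + K y x) x = (kop M K ^^ l) (\<lambda>y. 1 + K y x) x
       + (\<Sum>i<l. iter_one_plus (l - i) x * iter_one i x)"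
      by (subst kop_plus_one_power[OF A.section'_bounded[OF x] x])
         (auto simp: int Suc_diff_Suc simp del: funpow.simps intro!: sum.cong)
    \<comment> \<open>The constant 1 in the starting section supplies the missing term
      \<open>i = l\<close>.\<close>
    also have "(kop M K ^^ l) (\<lambda>y. 1 + K y x) x = iter_one l x + (kop M K ^^ l) (\<lambda>y. K y x) x"
      using x by (intro kop_power_add bounded_fun_const section'_bounded)
    finally show ?thesis
      by (simp add: lessThan_Suc_atMost[symmetric])
  qed
  have "kop_trace M (\<lambda>x y. 1 + K x y) l
      = (\<integral>x. (kop M K ^^ l) (\<lambda>y. K y x) x + (\<Sum>i\<le>l. iter_one_plus (l - i) x * iter_one i x) \<partial>M)"
    unfolding kop_trace_def using diag by (intro Bochner_Integration.integral_cong) auto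
  also have "\<dots> = kop_trace M K l + (\<Sum>i\<le>l. \<integral>x. iter_one_plus (l - i) x * iter_one i x \<partial>M)"
    using integral_add_lincomb[of "\<lambda>x. (kop M K ^^ l) (\<lambda>y. K y x) x" "{..l}"
        "\<lambda>i x. iter_one_plus (l - i) x * iter_one i x" "\<lambda>_. 1"]
    unfolding kop_trace_def
    by (simp add: bounded_fun_mult diag_bounded A.iter_one_bounded iter_one_bounded)
  also have "(\<Sum>i\<le>l. \<integral>x. iter_one_plus (l - i) x * iter_one i x \<partial>M)
      = (\<Sum>i\<le>l. moment l + (\<Sum>d<l - i. p d * moment (l - 1 - d)))"
  proof (intro sum.cong refl)
    fix i assume "i \<in> {..l}"
    then have "(\<Sum>j<l - i. p (l - i - 1 - j) * moment (j + i)) = (\<Sum>d<l - i. p d * moment (l - 1 - d))"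
      by (intro sum.reindex_bij_witness[of _ "\<lambda>d. l - i - 1 - d" "\<lambda>d. l - i - 1 - d"])
        (auto simp: add.commute)
    with \<open>i \<in> {..l}\<close> show "(\<integral>x. iter_one_plus (l - i) x * iter_one i x \<partial>M)
        = moment l + (\<Sum>d<l - i. p d * moment (l - 1 - d))"
      unfolding iter_one_plus_inner p_def by simp
  qed
  also have "\<dots> = (\<Sum>a\<le>l. moment l + (\<Sum>d<a. p d * moment (l - 1 - d)))"
    by (rule sum.reindex_bij_witness[of _ "\<lambda>a. l - a" "\<lambda>a. l - a"]) auto
  also have "\<dots> = weighted_power_coeff (\<lambda>r. real (Suc l) / real (Suc r)) l moment"
    by (rule cyclic_renewal_eq_weighted_power_coeff) (simp add: p_def iter_one_plus_integral)
  finally show ?thesis .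
qed

text \<open>The exponent \<open>l + 1\<close> is even, say 2 (k + 1). The trace is then the squared
  Hilbert-Schmidt norm of the power k + 1, whose kernel is the iterated section.\<close>

lemma kop_trace_odd_nonneg:
  assumes "odd l"
  shows "0 \<le> kop_trace M K l"
proof -
  obtain k where l: "l = Suc (k + k)"
    using assms by (metis oddE mult_2 Suc_eq_plus1)
  have "(kop M K ^^ l) (\<lambda>y. K y x) x = (\<integral>y. ((kop M K ^^ k) (\<lambda>y. K y x) y)\<^sup>2 \<partial>M)"
    if x: "x \<in> space M" for x
  proof -
    note b = section'_bounded[OF x]
    have "(kop M K ^^ l) (\<lambda>y. K y x) x = (\<integral>y. K y x * (kop M K ^^ k) ((kop M K ^^ k) (\<lambda>y. K y x)) y \<partial>M)"
      unfolding l funpow.simps o_apply funpow_add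
      by (subst kop_def) (intro Bochner_Integration.integral_cong refl, simp add: sym x)
    also have "\<dots> = (\<integral>y. (kop M K ^^ k) (\<lambda>y. K y x) y * (kop M K ^^ k) (\<lambda>y. K y x) y \<partial>M)"
      by (intro kop_power_self_adjoint kop_power_bounded b)
    finally show ?thesis by (simp add: power2_eq_square)
  qed
  then have "kop_trace M K l = (\<integral>x. \<integral>y. ((kop M K ^^ k) (\<lambda>y. K y x) y)\<^sup>2 \<partial>M \<partial>M)"
    unfolding kop_trace_def by (intro Bochner_Integration.integral_cong) auto
  then show ?thesis by simp
qed

section \<open>Adding the contributions of the kernel and its negative\<close>

lemma uminus_sym: "sym_kernel M (\<lambda>x y. - K x y)"
proof unfold_locales
  show "bounded_fun (M \<Otimes>\<^sub>M M) (\<lambda>(x, y). - K x y)"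
    using bounded_fun_mult[OF bounded_fun_const bounded, of "-1"] by (simp add: split_def)
qed (simp add: sym)

lemma moment_uminus: "sym_kernel.moment M (\<lambda>x y. - K x y) = (\<lambda>k. (-1) ^ k * moment k)"
proof
  fix k
  show "sym_kernel.moment M (\<lambda>x y. - K x y) k = (-1) ^ k * moment k"
    using kop_power_cmult[of k M "-1" K]
    by (simp add: moment_def sym_kernel.moment_def[OF uminus_sym])
qed

lemma walk_integral_sum_ge:
  assumes "2 \<le> n"
  shows "2 + 2 * real (n - 1) * moment 2
    \<le> (\<integral>x. (kop M (\<lambda>x y. 1 + K x y) ^^ n) (\<lambda>_. 1) x \<partial>M)
      + (\<integral>x. (kop M (\<lambda>x y. 1 - K x y) ^^ n) (\<lambda>_. 1) x \<partial>M)"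
  using weighted_power_coeff_even_part_ge[OF moment_power_even_nth_nonneg moment_0 _ assms, of "\<lambda>_. 1"]
    iter_one_plus_integral[of n] sym_kernel.iter_one_plus_integral[OF uminus_sym, of n]
  by (simp add: moment_uminus)

lemma kop_trace_uminus: "kop_trace M (\<lambda>x y. - K x y) l = (-1) ^ Suc l * kop_trace M K l"
  using kop_trace_cmult[of M "-1" K l] by simp

text \<open>Besides the weighted coefficients, the traces of the powers \<open>l + 1\<close> of both
  signs remain. For odd \<open>l\<close> they agree and are nonnegative, for even \<open>l\<close>
  they cancel.\<close>

lemma kop_trace_sum_ge:
  assumes "2 \<le> l"
  shows "2 + 2 * real l * moment 2
    \<le> kop_trace M (\<lambda>x y. 1 + K x y) l + kop_trace M (\<lambda>x y. 1 - K x y) l"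
proof -
  let ?\<alpha> = "\<lambda>r. real (Suc l) / real (Suc r)"
  have m2: "0 \<le> moment 2"
    using moment_power_even_nth_nonneg[of 1 1] by simp
  \<comment> \<open>The product of weight and exponent is exactly \<open>l + 1\<close>. It is
    weakened to \<open>l\<close>, one less than the length of the cycle, so that paths and cycles
    share one bound.\<close>
  have "real l * moment 2 \<le> ?\<alpha> (l - 2) * real (l - 1) * moment 2"
    using assms m2 by (intro mult_right_mono) (auto simp: field_simps of_nat_diff)
  moreover have "?\<alpha> l = 1" by simp
  ultimately have "2 + 2 * real l * moment 2 \<le> 2 * ?\<alpha> l + 2 * ?\<alpha> (l - 2) * real (l - 1) * moment 2"
    unfolding mult.assoc by linarith
  also have "\<dots> \<le> weighted_power_coeff ?\<alpha> l moment + weighted_power_coeff ?\<alpha> l (\<lambda>k. (-1) ^ k * moment k)"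
    using assms by (intro weighted_power_coeff_even_part_ge moment_power_even_nth_nonneg moment_0) auto
  also have "\<dots> \<le> kop_trace M (\<lambda>x y. 1 + K x y) l + kop_trace M (\<lambda>x y. 1 - K x y) l"
    using kop_trace_plus_one[of l] sym_kernel.kop_trace_plus_one[OF uminus_sym, of l]
      kop_trace_uminus[of l] kop_trace_odd_nonneg[of l]
    by (cases "even l") (simp_all add: moment_uminus)
  finally show ?thesis .
qed

end

section \<open>Homomorphism densities of paths and cycles\<close>

text \<open>Almost every section of a null set of pairs is null. As \<open>i\<close> and
  \<open>j\<close> differ, coordinate \<open>j\<close> can be integrated out first, so the preimage
  in the product is null. This carries almost everywhere equality of kernels to each edge.\<close>

lemma AE_PiM_pair:
  assumes "prob_space M" and V: "finite V" "i \<in> V" "j \<in> V" "i \<noteq> j"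
    and P: "AE p in M \<Otimes>\<^sub>M M. P (fst p) (snd p)"
  shows "AE x in PiM V (\<lambda>_. M). P (x i) (x j)"
proof -
  interpret prob_space M by fact
  interpret pair_prob_space M M ..
  interpret Q: product_sigma_finite "\<lambda>_. M" ..
  from P obtain N where N [measurable]: "N \<in> sets (M \<Otimes>\<^sub>M M)" and N0: "emeasure (M \<Otimes>\<^sub>M M) N = 0"
    and sub: "{p \<in> space (M \<Otimes>\<^sub>M M). \<not> P (fst p) (snd p)} \<subseteq> N"
    by (rule AE_E) auto
  have "N \<in> null_sets (M \<Otimes>\<^sub>M M)" using N N0 by auto
  then have "AE p in M \<Otimes>\<^sub>M M. p \<notin> N" by (rule AE_not_in)
  then have "AE x in M. AE y in M. (x, y) \<notin> N" by (rule AE_pair)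
  then have "AE x in M. (\<integral>\<^sup>+y. indicator N (x, y) \<partial>M) = 0"
  proof eventually_elim
    case (elim x)
    then have "(\<integral>\<^sup>+y. indicator N (x, y) \<partial>M) = (\<integral>\<^sup>+y. 0 \<partial>M)"
      by (intro nn_integral_cong_AE) (auto simp: indicator_def)
    then show ?case by simp
  qed
  then have zero: "AE x in PiM (V - {j}) (\<lambda>_. M). (\<integral>\<^sup>+y. indicator N (x i, y) \<partial>M) = 0"
    using V by (intro AE_PiM_component assms(1)) auto
  have V': "insert j (V - {j}) = V" using V by auto
  have meas: "(\<lambda>x. indicator N (x i, x j) :: ennreal) \<in> borel_measurable (PiM V (\<lambda>_. M))"
    using V by measurable
  have "(\<integral>\<^sup>+x. indicator N (x i, x j) \<partial>PiM (insert j (V - {j})) (\<lambda>_. M))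
      = (\<integral>\<^sup>+x. \<integral>\<^sup>+y. indicator N ((x(j := y)) i, (x(j := y)) j) \<partial>M \<partial>PiM (V - {j}) (\<lambda>_. M))"
    using V meas unfolding V' by (intro Q.product_nn_integral_insert[of "V - {j}" j, unfolded V']) auto
  also have "\<dots> = (\<integral>\<^sup>+x. 0 \<partial>PiM (V - {j}) (\<lambda>_. M))"
    using zero V by (intro nn_integral_cong_AE) simp
  finally have "(\<integral>\<^sup>+x. indicator N (x i, x j) \<partial>PiM V (\<lambda>_. M)) = 0"
    unfolding V' by simp
  then have "AE x in PiM V (\<lambda>_. M). indicator N (x i, x j) = (0 :: ennreal)"
    using nn_integral_0_iff_AE[OF meas] by simp
  with AE_space show ?thesis
  proof eventually_elim
    case (elim x)
    then have "(x i, x j) \<in> space (M \<Otimes>\<^sub>M M)"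
      using V by (auto simp: space_PiM space_pair_measure)
    with elim sub show ?case by (auto simp: indicator_def split: if_splits)
  qed
qed

section \<open>Borel versions of Lebesgue measurable kernels\<close>

abbreviation unit_measure :: "real measure" where
  "unit_measure \<equiv> restrict_space lborel {0..1}"

lemma prob_space_unit: "prob_space unit_measure"
  by (rule prob_spaceI) (simp add: space_restrict_space emeasure_restrict_space)

lemma unit_pair_measurable: "(\<lambda>p. p) \<in> measurable (unit_measure \<Otimes>\<^sub>M unit_measure) (lborel \<Otimes>\<^sub>M lborel)"
proof -
  have "(\<lambda>x. x) \<in> measurable unit_measure lborel"
    by (intro measurable_restrict_space1) simp
  then have "(\<lambda>p. (fst p, snd p)) \<in> measurable (unit_measure \<Otimes>\<^sub>M unit_measure) (lborel \<Otimes>\<^sub>M lborel)"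
    by (intro measurable_Pair measurable_compose[OF measurable_fst] measurable_compose[OF measurable_snd])
  then show ?thesis by simp
qed

lemma AE_unit_pair:
  assumes "AE p in lborel \<Otimes>\<^sub>M lborel. P p"
  shows "AE p in unit_measure \<Otimes>\<^sub>M unit_measure. P p"
proof -
  interpret M: prob_space unit_measure by (rule prob_space_unit)
  interpret MM: pair_prob_space unit_measure unit_measure ..
  from assms obtain N where N: "N \<in> sets (lborel \<Otimes>\<^sub>M lborel)" "emeasure (lborel \<Otimes>\<^sub>M lborel) N = 0"
    "{p \<in> space (lborel \<Otimes>\<^sub>M lborel). \<not> P p} \<subseteq> N"
    by (rule AE_E) auto
  then have "N \<in> null_sets (lborel \<Otimes>\<^sub>M lborel)" by auto
  then have "AE p in lborel \<Otimes>\<^sub>M lborel. p \<notin> N" by (rule AE_not_in)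
  then have "AE x in lborel. AE y in lborel. (x, y) \<notin> N" by (rule lborel_pair.AE_pair)
  then have "AE x in unit_measure. AE y in unit_measure. (x, y) \<notin> N"
    by (simp add: AE_restrict_space_iff) (auto elim!: eventually_mono)
  moreover have "{p \<in> space (unit_measure \<Otimes>\<^sub>M unit_measure). p \<notin> N} \<in> sets (unit_measure \<Otimes>\<^sub>M unit_measure)"
  proof -
    have "{p \<in> space (unit_measure \<Otimes>\<^sub>M unit_measure). p \<notin> N} = space (unit_measure \<Otimes>\<^sub>M unit_measure)
        - (\<lambda>p. p) -` N \<inter> space (unit_measure \<Otimes>\<^sub>M unit_measure)"
      by auto
    then show ?thesis
      using measurable_sets[OF unit_pair_measurable N(1)] by simp
  qed
  ultimately have "AE p in unit_measure \<Otimes>\<^sub>M unit_measure. p \<notin> N"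
    by (intro MM.AE_pair_measure)
  then show ?thesis
    using N(3) by (auto elim!: eventually_mono simp: space_pair_measure)
qed

text \<open>A Borel representative may violate the bound and the symmetry on a null set. Truncating
  and then symmetrising repairs both without changing it almost everywhere on the square.\<close>

lemma kernel_borel_version:
  assumes "is_kernel W"
  obtains W' where "bounded_fun (unit_measure \<Otimes>\<^sub>M unit_measure) (case_prod W')"
    "\<And>x y. W' x y = W' y x"
    "AE p in unit_measure \<Otimes>\<^sub>M unit_measure. W (fst p) (snd p) = W' (fst p) (snd p)"
proof -
  interpret M: prob_space unit_measure by (rule prob_space_unit)
  interpret MM: pair_prob_space unit_measure unit_measure ..
  let ?S = "{0..1} \<times> {0..1} :: (real \<times> real) set"
  let ?MM = "unit_measure \<Otimes>\<^sub>M unit_measure"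
  from assms obtain B where W: "case_prod W \<in> borel_measurable (lebesgue_on ?S)"
    and *: "\<forall>x\<in>{0..1}. \<forall>y\<in>{0..1}. W x y = W y x" "\<forall>x\<in>{0..1}. \<forall>y\<in>{0..1}. \<bar>W x y\<bar> \<le> B"
    unfolding is_kernel_def by auto
  then have sym: "\<And>x y. x \<in> {0..1} \<Longrightarrow> y \<in> {0..1} \<Longrightarrow> W x y = W y x"
    and B: "\<And>x y. x \<in> {0..1} \<Longrightarrow> y \<in> {0..1} \<Longrightarrow> \<bar>W x y\<bar> \<le> B"
    by blast+
  have "?S \<inter> space lebesgue \<in> sets lebesgue"
    by (auto intro!: sets_completionI_sets borel_closed closed_Times)
  with W have "(\<lambda>p. indicator ?S p *\<^sub>R case_prod W p) \<in> borel_measurable lebesgue"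
    by (subst (asm) borel_measurable_restrict_space_iff) auto
  from completion_ex_borel_measurable_real[OF this] obtain g where
    g: "g \<in> borel_measurable lborel" and g_AE: "AE p in lborel. indicator ?S p *\<^sub>R case_prod W p = g p"
    by auto
  define h where "h p = max (- B) (min B (g p))" for p
  have "g \<in> borel_measurable (lborel \<Otimes>\<^sub>M lborel)"
    using g by (simp add: lborel_prod)
  from measurable_compose[OF unit_pair_measurable this]
  have h [measurable]: "h \<in> borel_measurable ?MM"
    unfolding h_def by simp
  have "AE p in ?MM. indicator ?S p *\<^sub>R case_prod W p = g p"
    using g_AE by (intro AE_unit_pair, unfold lborel_prod)
  then have h_AE: "AE p in ?MM. W (fst p) (snd p) = h p"
    using AE_space
  proof eventually_elim
    case (elim p)
    then have "fst p \<in> {0..1}" "snd p \<in> {0..1}"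
      by (auto simp: space_pair_measure space_restrict_space)
    with elim B[of "fst p" "snd p"] show ?case
      by (cases p) (auto simp: h_def)
  qed
  \<comment> \<open>Swapping the coordinates preserves the product measure, so the equality also
    holds almost everywhere for the reflected functions.\<close>
  have h_AE': "AE p in ?MM. W (snd p) (fst p) = h (snd p, fst p)"
  proof -
    have "AE p in distr ?MM ?MM (\<lambda>(x, y). (y, x)). W (fst p) (snd p) = h p"
      by (subst MM.distr_pair_swap[symmetric]) (rule h_AE)
    from AE_distrD[OF measurable_pair_swap' this] show ?thesis
      by (simp add: split_def)
  qed
  have "0 \<le> B" using B[of 0 0] by simp
  then have h_bound: "\<bar>h p\<bar> \<le> B" for p by (auto simp: h_def)
  show ?thesis
  proof (rule that[of "\<lambda>x y. (h (x, y) + h (y, x)) / 2"])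
    have "\<bar>(h (x, y) + h (y, x)) / 2\<bar> \<le> B" for x y
      using h_bound[of "(x, y)"] h_bound[of "(y, x)"] by (auto simp: abs_le_iff)
    then show "bounded_fun ?MM (\<lambda>(x, y). (h (x, y) + h (y, x)) / 2)"
      unfolding bounded_fun_def by (auto intro!: exI[of _ B])
    show "AE p in ?MM. W (fst p) (snd p) = (h (fst p, snd p) + h (snd p, fst p)) / 2"
      using h_AE h_AE' AE_space
    proof eventually_elim
      case (elim p)
      then have "fst p \<in> {0..1}" "snd p \<in> {0..1}"
        by (auto simp: space_pair_measure space_restrict_space)
      with elim sym[of "fst p" "snd p"] show ?case by simp
    qed
  qed simp
qed

section \<open>Edge products and their invariance\<close>

definition edge_value :: "('b \<Rightarrow> 'b \<Rightarrow> real) \<Rightarrow> ('a \<Rightarrow> 'b) \<Rightarrow> 'a set \<Rightarrow> real" where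
  "edge_value W x e = (case SOME (i, j). e = {i, j} of (i, j) \<Rightarrow> W (x i) (x j))"

text \<open>The chosen order depends on \<open>e\<close> alone, so the same \<open>i\<close> and
  \<open>j\<close> serve all \<open>W\<close> and \<open>x\<close>. Two kernels can thus be compared
  on an edge without using symmetry.\<close>

lemma edge_value_cases:
  assumes "card e = 2"
  obtains i j where "e = {i, j}" "i \<noteq> j" "\<And>W x. edge_value W x e = W (x i) (x j)"
proof -
  define p where "p = (SOME (i, j). e = {i, j})"
  from assms obtain a b where "e = {a, b}" by (auto simp: card_2_iff)
  then have "case (a, b) of (i, j) \<Rightarrow> e = {i, j}" by simp
  then have "case p of (i, j) \<Rightarrow> e = {i, j}" unfolding p_def by (rule someI)
  then have "e = {fst p, snd p}" by (simp add: split_def)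
  moreover from this assms have "fst p \<noteq> snd p" by auto
  ultimately show ?thesis
    using that by (simp add: edge_value_def split_def p_def)
qed

lemma edge_value_sym:
  assumes "\<And>x y. W x y = W y x" "i \<noteq> j"
  shows "edge_value W x {i, j} = W (x i) (x j)"
proof -
  have "card {i, j} = 2" using assms(2) by simp
  then show ?thesis
    by (rule edge_value_cases) (auto simp: doubleton_eq_iff assms(1))
qed

lemma simple_graph_finite_edges:
  assumes "simple_graph F"
  shows "finite (edges F)"
  using assms finite_subset[of "edges F" "Pow (verts F)"] by (auto simp: simple_graph_def)

text \<open>The preimages under \<open>f\<close> and \<open>g\<close> differ by a null set. This
  gives measurability of the edge product of a kernel that is only Lebesgue measurable.\<close>

lemma measurable_completion_AE:
  assumes f: "f \<in> measurable (completion M) N" and g: "g \<in> space M \<rightarrow> space N"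
    and AE: "AE x in M. f x = g x"
  shows "g \<in> measurable (completion M) N"
proof (rule measurableI)
  fix A assume "A \<in> sets N"
  then have "f -` A \<inter> space (completion M) \<in> sets (completion M)"
    using f by (intro measurable_sets)
  then show "g -` A \<inter> space (completion M) \<in> sets (completion M)"
    by (rule completion.in_sets_AE[rotated]) (use AE in \<open>auto simp: AE_completion_iff elim!: eventually_mono\<close>)
qed (use g in auto)

lemma edge_product_measurable:
  assumes F: "simple_graph F"
    and W: "bounded_fun (M \<Otimes>\<^sub>M M) (case_prod W)"
  shows "(\<lambda>x. \<Prod>e\<in>edges F. edge_value W x e) \<in> borel_measurable (PiM (verts F) (\<lambda>_. M))"
proof (intro borel_measurable_prod)
  fix e assume e: "e \<in> edges F"
  with F have "card e = 2" "e \<subseteq> verts F" by (auto simp: simple_graph_def)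
  from \<open>card e = 2\<close> obtain i j where ij: "e = {i, j}"
    "\<And>x. edge_value W x e = W (x i) (x j)"
    by (metis edge_value_cases)
  have "bounded_fun (PiM (verts F) (\<lambda>_. M)) (\<lambda>x. W (x i) (x j))"
    using \<open>e \<subseteq> verts F\<close> ij(1)
    by (intro bounded_fun_compose2[OF W] measurable_component_singleton) auto
  then show "(\<lambda>x. edge_value W x e) \<in> borel_measurable (PiM (verts F) (\<lambda>_. M))"
    by (simp add: ij(2) bounded_fun_def)
qed

lemma hom_density_borel_version:
  assumes F: "simple_graph F"
    and W': "bounded_fun (unit_measure \<Otimes>\<^sub>M unit_measure) (case_prod W')"
    and AE: "AE p in unit_measure \<Otimes>\<^sub>M unit_measure. W (fst p) (snd p) = W' (fst p) (snd p)"
  shows "hom_density F W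
    = (LINT x|PiM (verts F) (\<lambda>_. unit_measure). (\<Prod>e\<in>edges F. edge_value W' x e))"
proof -
  let ?M = "PiM (verts F) (\<lambda>_. unit_measure)"
  let ?f = "\<lambda>W x. \<Prod>e\<in>edges F. edge_value W x e"
  have meas: "?f W' \<in> borel_measurable ?M"
    by (rule edge_product_measurable[OF F W'])
  have "AE x in ?M. \<forall>e\<in>edges F. edge_value W x e = edge_value W' x e"
  proof (rule AE_finite_allI[OF simple_graph_finite_edges[OF F]])
    fix e assume e: "e \<in> edges F"
    with F have "card e = 2" "e \<subseteq> verts F" by (auto simp: simple_graph_def)
    from \<open>card e = 2\<close> obtain i j where ij: "e = {i, j}" "i \<noteq> j"
      "\<And>x. edge_value W x e = W (x i) (x j)" "\<And>x. edge_value W' x e = W' (x i) (x j)"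
      by (metis edge_value_cases)
    have "AE x in ?M. W (x i) (x j) = W' (x i) (x j)"
      using F \<open>e \<subseteq> verts F\<close> ij
      by (intro AE_PiM_pair prob_space_unit AE) (auto simp: simple_graph_def)
    then show "AE x in ?M. edge_value W x e = edge_value W' x e"
      by (simp add: ij(3,4))
  qed
  then have eq: "AE x in ?M. ?f W' x = ?f W x"
    by eventually_elim simp
  have meas': "?f W' \<in> borel_measurable (completion ?M)"
    using meas by (rule measurable_completion)
  have "?f W \<in> borel_measurable (completion ?M)"
    by (rule measurable_completion_AE[OF meas' _ eq]) simp
  then have "hom_density F W = integral\<^sup>L (completion ?M) (?f W')"
    unfolding hom_density_def edge_value_def[symmetric]
    using meas' AE_completion[OF eq] by (intro integral_cong_AE) auto
  then show ?thesis using meas by (simp add: integral_completion)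
qed

lemma inj_on_edge_image:
  assumes "simple_graph F" "inj_on f (verts F)"
  shows "inj_on (\<lambda>e. f ` e) (edges F)"
  using assms by (intro inj_onI) (metis inj_on_image_eq_iff simple_graph_def)

text \<open>Relabelling coordinates along the bijection carries one product measure to the other.
  Symmetry of \<open>W'\<close> removes the dependence on the order chosen for each edge in the two
  graphs.\<close>

lemma hom_density_iso:
  assumes F: "simple_graph F" and iso: "graph_iso F G"
    and W': "bounded_fun (unit_measure \<Otimes>\<^sub>M unit_measure) (case_prod W')"
    and sym: "\<And>x y. W' x y = W' y x"
    and AE: "AE p in unit_measure \<Otimes>\<^sub>M unit_measure. W (fst p) (snd p) = W' (fst p) (snd p)"
  shows "hom_density F W
    = (LINT x|PiM (verts G) (\<lambda>_. unit_measure). (\<Prod>e\<in>edges G. edge_value W' x e))"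
proof -
  let ?M = "\<lambda>V. PiM V (\<lambda>_. unit_measure)"
  from iso obtain f where f: "bij_betw f (verts F) (verts G)" "edges G = (\<lambda>e. f ` e) ` edges F"
    unfolding graph_iso_def by auto
  have inj: "inj_on (\<lambda>e. f ` e) (edges F)"
    using f(1) by (intro inj_on_edge_image[OF F]) (simp add: bij_betw_def)
  have distr: "distr (?M (verts G)) (?M (verts F)) (\<lambda>\<omega>. \<lambda>n\<in>verts F. \<omega> (f n)) = ?M (verts F)"
    using f(1) distr_PiM_reindex[of "verts G" "\<lambda>_. unit_measure" f "verts F"]
    by (auto simp: prob_space_unit bij_betw_def)
  have edge: "edge_value W' (\<lambda>n\<in>verts F. x (f n)) e = edge_value W' x (f ` e)"
    if "e \<in> edges F" for x e
  proof -
    from that F have "card e = 2" "e \<subseteq> verts F" by (auto simp: simple_graph_def)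
    then obtain i j where e: "e = {i, j}" "i \<noteq> j" "i \<in> verts F" "j \<in> verts F"
      by (auto simp: card_2_iff)
    then have "f i \<noteq> f j" using f(1) by (auto simp: bij_betw_def inj_on_def)
    with e show ?thesis by (simp add: edge_value_sym sym)
  qed
  have meas: "(\<lambda>x. \<Prod>e\<in>edges F. edge_value W' x e) \<in> borel_measurable (?M (verts F))"
    by (rule edge_product_measurable[OF F W'])
  have "hom_density F W = (LINT x|?M (verts F). (\<Prod>e\<in>edges F. edge_value W' x e))"
    by (rule hom_density_borel_version[OF F W' AE])
  also have "\<dots> = (LINT x|distr (?M (verts G)) (?M (verts F)) (\<lambda>\<omega>. \<lambda>n\<in>verts F. \<omega> (f n)).
      (\<Prod>e\<in>edges F. edge_value W' x e))"
    unfolding distr ..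
  also have "\<dots> = (LINT x|?M (verts G). (\<Prod>e\<in>edges F. edge_value W' (\<lambda>n\<in>verts F. x (f n)) e))"
    using f(1) meas by (intro integral_distr measurable_restrict measurable_component_singleton)
      (auto simp: bij_betw_def)
  also have "\<dots> = (LINT x|?M (verts G). (\<Prod>e\<in>edges G. edge_value W' x e))"
    unfolding f(2) by (simp add: prod.reindex[OF inj] edge)
  finally show ?thesis .
qed

lemma card_edges_iso:
  assumes F: "simple_graph F" and iso: "graph_iso F G"
  shows "card (edges F) = card (edges G)"
proof -
  from iso obtain f where f: "bij_betw f (verts F) (verts G)" "edges G = (\<lambda>e. f ` e) ` edges F"
    unfolding graph_iso_def by auto
  have inj: "inj_on (\<lambda>e. f ` e) (edges F)"
    using f(1) by (intro inj_on_edge_image[OF F]) (simp add: bij_betw_def)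
  then show ?thesis unfolding f(2) by (simp add: card_image)
qed

section \<open>Path and cycle graphs\<close>

lemma edges_path_graph: "edges (path_graph k) = (\<lambda>i. {i, Suc i}) ` {..<k}"
  by (auto simp: path_graph_def)

lemma inj_path_edge: "inj_on (\<lambda>i. {i, Suc i}) A"
  by (auto simp: inj_on_def doubleton_eq_iff)

lemma edges_cycle_graph: "edges (cycle_graph n) = (\<lambda>i. {i, Suc i mod n}) ` {..<n}"
  by (auto simp: cycle_graph_def)

lemma mod_Suc_less: "i < n \<Longrightarrow> Suc i mod n = (if Suc i = n then 0 else Suc i)"
  by auto

text \<open>The bound 3 matters: for \<open>n = 2\<close> both indices give the same edge.
  Injectivity yields both the edge count and the product over indices.\<close>

lemma inj_cycle_edge:
  assumes "3 \<le> n"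
  shows "inj_on (\<lambda>i. {i, Suc i mod n}) {..<n}"
proof (rule inj_onI)
  fix i j assume "i \<in> {..<n}" "j \<in> {..<n}" "{i, Suc i mod n} = {j, Suc j mod n}"
  with assms show "i = j"
    by (auto simp: mod_Suc_less doubleton_eq_iff split: if_splits)
qed

lemma simple_path_graph: "simple_graph (path_graph k)"
  by (auto simp: simple_graph_def path_graph_def card_insert_if)

lemma graph_iso_refl: "graph_iso F F"
  unfolding graph_iso_def by (intro exI[of _ id]) auto

text \<open>Symmetry of \<open>W'\<close> is required at all real arguments so that edge products
  can be rewritten at every assignment \<open>x\<close>.\<close>

locale borel_version =
  fixes W W' :: "real \<Rightarrow> real \<Rightarrow> real"
  assumes bounded: "bounded_fun (unit_measure \<Otimes>\<^sub>M unit_measure) (case_prod W')"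
    and sym_all: "W' x y = W' y x"
    and AE_eq: "AE p in unit_measure \<Otimes>\<^sub>M unit_measure. W (fst p) (snd p) = W' (fst p) (snd p)"
begin

sublocale sym_kernel unit_measure W'
  using prob_space_unit bounded sym_all
  by (simp add: sym_kernel_def sym_kernel_axioms_def bounded_kernel_def bounded_kernel_axioms_def)

lemma affine: "borel_version (\<lambda>x y. a + b * W x y) (\<lambda>x y. a + b * W' x y)"
proof
  show "bounded_fun (unit_measure \<Otimes>\<^sub>M unit_measure) (\<lambda>(x, y). a + b * W' x y)"
    using bounded_fun_add[OF bounded_fun_const bounded_fun_mult[OF bounded_fun_const bounded], of a b]
    by (simp add: split_def)
  show "AE p in unit_measure \<Otimes>\<^sub>M unit_measure. a + b * W (fst p) (snd p) = a + b * W' (fst p) (snd p)"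
    using AE_eq by eventually_elim simp
qed (simp add: sym_all)

lemma hom_density_path:
  assumes "simple_graph F" "graph_iso F (path_graph k)"
  shows "hom_density F W = (\<integral>x. (kop unit_measure W' ^^ k) (\<lambda>_. 1) x \<partial>unit_measure)"
proof -
  have "hom_density F W = (LINT x|PiM {..k} (\<lambda>_. unit_measure). (\<Prod>e\<in>edges (path_graph k). edge_value W' x e))"
    using hom_density_iso[OF assms bounded sym_all AE_eq] by (simp add: path_graph_def)
  also have "\<dots> = (LINT x|PiM {..k} (\<lambda>_. unit_measure). (\<Prod>i<k. W' (x i) (x (Suc i))) * 1)"
    by (simp add: edges_path_graph prod.reindex[OF inj_path_edge] edge_value_sym sym_all)
  also have "\<dots> = (\<integral>x. (kop unit_measure W' ^^ k) (\<lambda>_. 1) x \<partial>unit_measure)"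
    using bounded_fun_const[of "unit_measure \<Otimes>\<^sub>M unit_measure" 1]
    by (intro PiM_walk_integral[of "\<lambda>_ _. 1"]) (simp add: split_def)
  finally show ?thesis .
qed

text \<open>The edge from the last vertex back to 0 becomes the closing function of the walk
  integral. The index is \<open>n - 1\<close> because \<open>kop_trace\<close> takes the power one
  higher.\<close>

lemma hom_density_cycle:
  assumes "simple_graph F" "graph_iso F (cycle_graph n)" "3 \<le> n"
  shows "hom_density F W = kop_trace unit_measure W' (n - 1)"
proof -
  obtain k where n: "n = Suc k" using assms(3) by (cases n) auto
  have V: "{..<n} = {..k}" by (auto simp: n)
  have "hom_density F W = (LINT x|PiM {..k} (\<lambda>_. unit_measure). (\<Prod>e\<in>edges (cycle_graph n). edge_value W' x e))"
    using hom_density_iso[OF assms(1,2) bounded sym_all AE_eq] by (simp add: cycle_graph_def V)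
  also have "\<dots> = (LINT x|PiM {..k} (\<lambda>_. unit_measure). (\<Prod>i<k. W' (x i) (x (Suc i))) * W' (x k) (x 0))"
  proof (intro Bochner_Integration.integral_cong refl)
    fix x :: "nat \<Rightarrow> real"
    have "(\<Prod>e\<in>edges (cycle_graph n). edge_value W' x e) = (\<Prod>i<n. edge_value W' x {i, Suc i mod n})"
      by (simp add: edges_cycle_graph prod.reindex[OF inj_cycle_edge[OF assms(3)]])
    also have "\<dots> = (\<Prod>i<n. W' (x i) (x (Suc i mod n)))"
      using assms(3) by (intro prod.cong refl edge_value_sym sym_all) (auto simp: mod_Suc_less)
    also have "\<dots> = (\<Prod>i<k. W' (x i) (x (Suc i))) * W' (x k) (x 0)"
      by (simp add: n)
    finally show "(\<Prod>e\<in>edges (cycle_graph n). edge_value W' x e)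
        = (\<Prod>i<k. W' (x i) (x (Suc i))) * W' (x k) (x 0)" .
  qed
  also have "\<dots> = kop_trace unit_measure W' (n - 1)"
    using bounded_fun_compose2[OF bounded measurable_snd measurable_fst] PiM_walk_integral[of "\<lambda>x y. W' y x" k]
    by (simp add: n kop_trace_def split_def)
  finally show ?thesis .
qed

end

lemma half_power_cancel: "2 ^ n * ((1/2) ^ n * a + (1/2) ^ n * b) = (a + b :: real)"
  by (simp add: power_divide field_simps)

theorem theorem4p1:
  fixes H :: "'a graph" and W :: "real \<Rightarrow> real \<Rightarrow> real" and \<epsilon> :: real
  assumes "(is_path H \<and> card (edges H) \<ge> 2) \<or> is_cycle H"
    and "is_kernel W"
    and "\<epsilon> \<ge> 0"
    and "hom_density H W + hom_density H (\<lambda>x y. 1 - W x y)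
           \<le> 2 powi (1 - int (card (edges H))) * (1 + \<epsilon>)"
  shows "hom_density (path_graph 2) (\<lambda>x y. 2 * W x y - 1)
           \<le> \<epsilon> / (real (card (edges H)) - 1)"
proof -
  let ?n = "card (edges H)"
  obtain W' where W': "borel_version W W'"
    by (rule kernel_borel_version[OF assms(2)]) (blast intro: borel_version.intro)
  define U where "U = (\<lambda>x y. 2 * W' x y - 1)"
  have "(\<lambda>x y. -1 + 2 * V x y) = (\<lambda>x y. 2 * V x y - 1)" for V :: "real \<Rightarrow> real \<Rightarrow> real"
    by (simp add: fun_eq_iff)
  then interpret U: borel_version "\<lambda>x y. 2 * W x y - 1" U
    using borel_version.affine[OF W', of "-1" 2] by (simp only: U_def)
  \<comment> \<open>Both kernels are written as one half of \<open>1 + U\<close> or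
    \<open>1 - U\<close>, so that scaling pulls out a power of 1/2.\<close>
  have "W' = (\<lambda>x y. 1/2 * (1 + U x y))"
    by (simp add: U_def fun_eq_iff)
  then interpret W: borel_version W "\<lambda>x y. 1/2 * (1 + U x y)"
    using W' by (simp only:)
  have "(\<lambda>x y. 1 + -1 * W x y) = (\<lambda>x y. 1 - W x y)"
    "(\<lambda>x y. 1 + -1 * W' x y) = (\<lambda>x y. 1/2 * (1 - U x y))"
    by (simp_all add: U_def fun_eq_iff)
  then interpret W1: borel_version "\<lambda>x y. 1 - W x y" "\<lambda>x y. 1/2 * (1 - U x y)"
    using borel_version.affine[OF W', of 1 "-1"] by (simp only:)
  have P2: "hom_density (path_graph 2) (\<lambda>x y. 2 * W x y - 1) = U.moment 2"
    unfolding U.moment_def by (rule U.hom_density_path[OF simple_path_graph graph_iso_refl])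
  \<comment> \<open>Multiplication by 2 to the number of edges absorbs the halves, and paths and
    cycles then satisfy the same inequality.\<close>
  have "2 \<le> ?n \<and> 2 + 2 * (real ?n - 1) * U.moment 2
      \<le> 2 ^ ?n * (hom_density H W + hom_density H (\<lambda>x y. 1 - W x y))"
    using assms(1)
  proof
    assume "is_path H \<and> 2 \<le> ?n"
    then obtain k where H: "simple_graph H" "graph_iso H (path_graph k)" and n: "2 \<le> ?n"
      by (auto simp: is_path_def)
    have k: "?n = k"
      using card_edges_iso[OF H] by (simp add: edges_path_graph card_image[OF inj_path_edge])
    have "hom_density H W = (1/2) ^ k * (\<integral>x. (kop unit_measure (\<lambda>x y. 1 + U x y) ^^ k) (\<lambda>_. 1) x \<partial>unit_measure)"
      unfolding W.hom_density_path[OF H] kop_power_cmult by (rule integral_mult_right_zero)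
    moreover have "hom_density H (\<lambda>x y. 1 - W x y)
        = (1/2) ^ k * (\<integral>x. (kop unit_measure (\<lambda>x y. 1 - U x y) ^^ k) (\<lambda>_. 1) x \<partial>unit_measure)"
      unfolding W1.hom_density_path[OF H] kop_power_cmult by (rule integral_mult_right_zero)
    moreover have "2 + 2 * (real k - 1) * U.moment 2
        \<le> (\<integral>x. (kop unit_measure (\<lambda>x y. 1 + U x y) ^^ k) (\<lambda>_. 1) x \<partial>unit_measure)
          + (\<integral>x. (kop unit_measure (\<lambda>x y. 1 - U x y) ^^ k) (\<lambda>_. 1) x \<partial>unit_measure)"
      using U.walk_integral_sum_ge[of k] n k by (simp only: of_nat_diff of_nat_1)
    ultimately show ?thesis
      using n unfolding k by (auto simp only: half_power_cancel)
  next
    assume "is_cycle H"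
    then obtain n where H: "simple_graph H" "graph_iso H (cycle_graph n)" and n: "3 \<le> n"
      by (auto simp: is_cycle_def)
    have k: "?n = n"
      using card_edges_iso[OF H] by (simp add: edges_cycle_graph card_image[OF inj_cycle_edge[OF n]])
    have n': "Suc (n - 1) = n" using n by simp
    have "hom_density H W = (1/2) ^ n * kop_trace unit_measure (\<lambda>x y. 1 + U x y) (n - 1)"
      unfolding W.hom_density_cycle[OF H n] kop_trace_cmult n' ..
    moreover have "hom_density H (\<lambda>x y. 1 - W x y) = (1/2) ^ n * kop_trace unit_measure (\<lambda>x y. 1 - U x y) (n - 1)"
      unfolding W1.hom_density_cycle[OF H n] kop_trace_cmult n' ..
    moreover have "2 + 2 * (real n - 1) * U.moment 2
        \<le> kop_trace unit_measure (\<lambda>x y. 1 + U x y) (n - 1) + kop_trace unit_measure (\<lambda>x y. 1 - U x y) (n - 1)"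
      using U.kop_trace_sum_ge[of "n - 1"] n by (simp add: of_nat_diff)
    ultimately show ?thesis
      using n unfolding k by (auto simp only: half_power_cancel)
  qed
  then have n: "2 \<le> ?n" and ge: "2 + 2 * (real ?n - 1) * U.moment 2
      \<le> 2 ^ ?n * (hom_density H W + hom_density H (\<lambda>x y. 1 - W x y))"
    by auto
  note ge
  also have "2 ^ ?n * (hom_density H W + hom_density H (\<lambda>x y. 1 - W x y))
      \<le> 2 ^ ?n * (2 powi (1 - int ?n) * (1 + \<epsilon>))"
    using assms(4) by (intro mult_left_mono) auto
  \<comment> \<open>The powers of 2 combine to 2, and this constant cancels against the degree 0
    contribution on the left.\<close>
  also have "\<dots> = 2 * (1 + \<epsilon>)"
    by (simp add: power_int_diff)
  finally have "(real ?n - 1) * U.moment 2 \<le> \<epsilon>" by (simp add: algebra_simps)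
  then show ?thesis
    unfolding P2 using n by (simp add: pos_le_divide_eq mult.commute)
qed

end
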